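(* For $t>0$ put $V_{\tilde C}(it)=i[1-t\beta(t/2)]$ and $V_{\tilde S}(it)=i[t\psi(t/2)-t\log(t/2)+1]$, and let $V_{\tilde T}$ be the function on $i(\mathbb{R}\setminus\{0\})$ given by $$V_{\tilde T}(it)=V_{\tilde C}(it)-V_{\tilde S}(it)= it\,[\,\log(t/2)-\beta(t/2)-\psi(t/2)\,],\quad t>0,\qquad V_{\tilde T}(-it)=\overline{V_{\tilde T}(it)},\quad t>0.$$ Then $V_{\tilde T}$ has a representation $$V_{\tilde T}(it)=a_{\tilde T}+\int_{\mathbb{R}}\frac{1+itx}{it-x}\,m_{\tilde T}(dx),\qquad t\in\mathbb{R}\setminus\{0\},$$ with $a_{\tilde T}\in\mathbb{R}$ and $m_{\tilde T}$ a non-negative finite Borel measure on $\mathbb{R}$, in which $a_{\tilde T}=0$, the total mass is $m_{\tilde T}(\mathbb{R})=\frac{\pi}{2}-\gamma-\log 2$, and the characteristic function $\hat m_{\tilde T}(s)=\int_{\mathbb{R}}e^{isx}\,m_{\tilde T}(dx)$ satisfies, for all $s>0$, $$\hat m_{\tilde T}(s)=\frac{\pi}{2}e^{-s}+2\sinh(s)\tan^{-1}(e^{-s})-\cosh(s)\log(1+e^{-s})-\frac{e^{-s}}{2}\left(Ei(s)-\log(1-e^{-s})\right)-\frac{e^{s}}{2}\left(Ei(-s)-\log(1-e^{-s})\right)$$ $$=\int_0^\infty\cos(sx)\,\frac{|x|}{1+x^2}\,\frac{e^{-\pi|x|/4}}{\cosh(\pi|x|/4)}\,dx .$$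
   Context: $\psi(z)=\frac{d}{dz}\log\Gamma(z)$ is the digamma function, $\gamma$ is Euler's constant, and $\tan^{-1}$ is the arctangent. The beta function of one variable is $\beta(x)=\frac12\left[\psi\left(\frac{x+1}{2}\right)-\psi\left(\frac{x}{2}\right)\right]=\sum_{k=0}^\infty\frac{(-1)^k}{x+k}$. $Ei$ is the exponential integral function: $Ei(x)=-\int_{-x}^\infty\frac{e^{-t}}{t}\,dt$ for $x<0$, and for $x>0$ it is the principal value $Ei(x)=-\lim_{\epsilon\to0^+}\left[\int_{-x}^{-\epsilon}\frac{e^{-t}}{t}\,dt+\int_{\epsilon}^\infty\frac{e^{-t}}{t}\,dt\right]$, equivalently $Ei(x)=\gamma+\log x+\sum_{k=1}^\infty\frac{x^k}{k\cdot k!}$. *)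

theory Defs
  imports "HOL-Probability.Probability"
begin

text \<open>The beta function of one variable, equal to the alternating series
  \<open>\<Sum>k. (-1)^k / (x + k)\<close>; not Euler's two-variable \<^const>\<open>Beta\<close>.\<close>

definition beta1 :: "real \<Rightarrow> real" where
  "beta1 x = (Digamma ((x + 1) / 2) - Digamma (x / 2)) / 2"

text \<open>The exponential integral, as a Cauchy principal value for \<open>x > 0\<close>.  It is used for
  \<open>x \<noteq> 0\<close> only; the value at \<open>0\<close> carries no meaning.\<close>

definition Ei :: "real \<Rightarrow> real" where
  "Ei x = (if x < 0 then - (LBINT t:{-x..}. exp (- t) / t)
           else Lim (at_right 0)
             (\<lambda>\<epsilon>. - ((LBINT t:{-x..-\<epsilon>}. exp (- t) / t) + (LBINT t:{\<epsilon>..}. exp (- t) / t))))"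

end

theory Submission
  imports Defs
begin

text \<open>The measure has the even density \<open>w(x) = \<bar>x\<bar> / (1 + x^2) * 1 / (1 + exp (pi \<bar>x\<bar> / 2))\<close>.
  Everything rests on one transform pair, \<open>fermi_sine_transform\<close>: for real \<open>v \<noteq> 0\<close>, the function
  \<open>G(v) = 1 / v - 2 / sinh (2 v)\<close> is the sine transform of \<open>2 / (1 + exp (pi x / 2))\<close> on the
  half-line.  This is the partial fraction expansion of the hyperbolic cosecant, which follows
  from the reflection formula for the Gamma function.

  Since \<open>x / (x^2 + t^2)\<close> is the Laplace transform of \<open>sin (x u)\<close> at \<open>t\<close>, Fubini's theorem turns
  integrals against \<open>w\<close> into Laplace integrals of \<open>G\<close> (\<open>fermi_poisson_transform\<close>).

  For the values of \<open>V_T\<close>, symmetry reduces the Nevanlinna integral at \<open>i t\<close>, where \<open>t > 0\<close>, to \<open>- i t\<close>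
  times the Laplace transform of \<open>G\<close> at \<open>t\<close>.  That transform satisfies a first-order difference
  equation in \<open>t\<close> with step \<open>4\<close>, by Frullani's integral, and tends to zero at infinity.  Hence it
  equals \<open>Digamma (t / 4 + 1 / 2) - ln (t / 4)\<close> (\<open>csch_laplace_eq_Digamma\<close>), which the
  duplication formula rewrites as \<open>beta1 (t / 2) + Digamma (t / 2) - ln (t / 2)\<close>.  At \<open>t = 1\<close> it is
  the total mass.

  For the characteristic function at \<open>s > 0\<close>, the same exchange gives the integrals of
  \<open>exp (- v) * G(v)\<close> over the half-lines from \<open>s\<close> and from \<open>- s\<close>.  Splitting \<open>G\<close> into its two terms
  separates an exponential integral from a function that is elementary in \<open>exp (- v)\<close>.  On the
  second half-line both terms are singular at \<open>0\<close>, but \<open>G\<close> is bounded, so the integral is the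
  limit over domains with a symmetric gap around \<open>0\<close>.  The elementary part converges there,
  and the remaining limit is the principal value \<open>Ei s\<close> (\<open>Ei_plus\<close>).\<close>

section \<open>Laplace integrals of the exponential and the sine\<close>

lemma set_integrable_exp_Ioi:
  fixes t :: real assumes "t > 0"
  shows "set_integrable lborel {0<..} (\<lambda>u. exp (- t * u))"
  using integrable_I0i_exp_mscale[OF assms] by (simp add: mult.commute)

lemma set_integral_exp_Ioi:
  fixes t :: real assumes "t > 0"
  shows "(LBINT u:{0<..}. exp (- t * u)) = 1 / t"
  using LBINT_I0i_exp_mscale[OF assms] by (simp add: mult.commute interval_lebesgue_integral_0_infty)

lemma exp_neg_mult_tendsto_0:
  fixes t :: real assumes "t > 0"
  shows "((\<lambda>u. exp (- t * u)) \<longlongrightarrow> 0) at_top"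
  using assms by real_asymp

lemma set_integrable_exp_sin_Ioi:
  fixes t x :: real assumes "t > 0"
  shows "set_integrable lborel {0<..} (\<lambda>u. exp (- t * u) * sin (x * u))"
proof (rule set_integrable_bound[OF set_integrable_exp_Ioi[OF assms]])
  show "set_borel_measurable lborel {0<..} (\<lambda>u. exp (- t * u) * sin (x * u))"
    unfolding set_borel_measurable_def by measurable
qed (auto simp: abs_mult intro!: mult_left_le)

lemma set_integral_exp_sin_Ioi:
  fixes t x :: real assumes t: "t > 0"
  shows "(LBINT u:{0<..}. exp (- t * u) * sin (x * u)) = x / (x\<^sup>2 + t\<^sup>2)"
proof -
  define D where "D = x\<^sup>2 + t\<^sup>2"
  have pos: "D > 0" unfolding D_def using t by (simp add: add_nonneg_pos)
  let ?F = "\<lambda>u. - exp (- t * u) * (t * sin (x * u) + x * cos (x * u)) / D"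
  have "(LBINT u=0..\<infinity>. exp (- t * u) * sin (x * u)) = 0 - (- x / D)"
  proof (rule interval_integral_FTC_integrable)
    fix u :: real
    have "(?F has_real_derivative exp (- t * u) * sin (x * u)) (at u)"
      using pos by (auto intro!: derivative_eq_intros) (simp add: field_simps, simp add: D_def power2_eq_square algebra_simps)
    thus "(?F has_vector_derivative exp (- t * u) * sin (x * u)) (at u)"
      by (simp add: has_real_derivative_iff_has_vector_derivative)
  next
    show "set_integrable lborel (einterval 0 \<infinity>) (\<lambda>u. exp (- t * u) * sin (x * u))"
      using set_integrable_exp_sin_Ioi[OF t, of x]
      by (simp add: einterval_def zero_ereal_def greaterThan_def)
  next
    have "(?F \<longlongrightarrow> - exp (- t * 0) * (t * sin (x * 0) + x * cos (x * 0)) / D) (at_right 0)"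
      using pos by (intro tendsto_intros) auto
    thus "((?F \<circ> real_of_ereal) \<longlongrightarrow> - x / D) (at_right 0)"
      by (simp add: zero_ereal_def ereal_tendsto_simps)
  next
    have "(?F \<longlongrightarrow> 0) at_top"
    proof (rule Lim_null_comparison)
      show "\<forall>\<^sub>F u in at_top. norm (?F u) \<le> exp (- t * u) * ((t + \<bar>x\<bar>) / D)"
      proof (intro always_eventually allI)
        fix u
        have "\<bar>t * sin (x * u) + x * cos (x * u)\<bar> \<le> \<bar>t * sin (x * u)\<bar> + \<bar>x * cos (x * u)\<bar>"
          by (rule abs_triangle_ineq)
        also have "\<dots> \<le> t + \<bar>x\<bar>"
          using t by (intro add_mono) (auto simp: abs_mult intro!: mult_left_le)
        finally show "norm (?F u) \<le> exp (- t * u) * ((t + \<bar>x\<bar>) / D)"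
          using pos by (simp add: abs_mult divide_right_mono)
      qed
      show "((\<lambda>u. exp (- t * u) * ((t + \<bar>x\<bar>) / D)) \<longlongrightarrow> 0) at_top"
        by (rule tendsto_mult_left_zero[OF exp_neg_mult_tendsto_0[OF t]])
    qed
    thus "((?F \<circ> real_of_ereal) \<longlongrightarrow> 0) (at_left \<infinity>)"
      by (simp add: ereal_tendsto_simps)
  qed auto
  thus ?thesis by (simp add: interval_lebesgue_integral_0_infty D_def)
qed

section \<open>Partial fractions of the hyperbolic cosecant\<close>

text \<open>The logarithmic derivative of Euler's reflection formula for \<open>Gamma\<close>.\<close>
lemma Digamma_reflection:
  fixes z :: complex assumes "z \<notin> \<int>"
  shows "Digamma (1 - z) - Digamma z = of_real pi * cot (of_real pi * z)"
proof -
  have z': "1 - z \<notin> \<int>" using assms Ints_diff[of 1 "1 - z"] by auto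
  have sin0: "sin (of_real pi * z) \<noteq> 0" using assms by (subst sin_eq_0) auto
  have nz: "z \<notin> \<int>\<^sub>\<le>\<^sub>0" "1 - z \<notin> \<int>\<^sub>\<le>\<^sub>0" using assms z' nonpos_Ints_subset_Ints by auto
  have "((\<lambda>w. Gamma w * Gamma (1 - w)) has_field_derivative
          Gamma z * Gamma (1 - z) * (Digamma z - Digamma (1 - z))) (at z)"
    using nz by (auto intro!: derivative_eq_intros simp: algebra_simps)
  moreover have "((\<lambda>w. of_real pi / sin (of_real pi * w)) has_field_derivative
          - (of_real pi / sin (of_real pi * z)) * (of_real pi * cot (of_real pi * z))) (at z)"
    using sin0 by (auto intro!: derivative_eq_intros simp: cot_def)
  ultimately have "Gamma z * Gamma (1 - z) * (Digamma z - Digamma (1 - z)) =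
      - (of_real pi / sin (of_real pi * z)) * (of_real pi * cot (of_real pi * z))"
    unfolding Gamma_reflection_complex by (rule DERIV_unique)
  hence "(of_real pi / sin (of_real pi * z)) * (Digamma (1 - z) - Digamma z) =
      (of_real pi / sin (of_real pi * z)) * (of_real pi * cot (of_real pi * z))"
    unfolding Gamma_reflection_complex by (simp add: algebra_simps)
  thus ?thesis using sin0 by (subst (asm) mult_cancel_left) auto
qed

lemma cot_half_add_tan_half:
  fixes z :: complex assumes "sin z \<noteq> 0"
  shows "cot (z / 2) + tan (z / 2) = 2 / sin z"
proof -
  have s: "sin z = 2 * sin (z / 2) * cos (z / 2)" using sin_double[of "z / 2"] by simp
  hence nz: "sin (z / 2) \<noteq> 0" "cos (z / 2) \<noteq> 0" using assms by auto
  have "cot (z / 2) + tan (z / 2) = ((sin (z/2))\<^sup>2 + (cos (z/2))\<^sup>2) / (sin (z / 2) * cos (z / 2))"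
    using nz by (simp add: cot_def tan_def power2_eq_square field_simps)
  thus ?thesis using nz by (simp add: s)
qed

text \<open>By reflection at \<open>z / 2\<close> and at \<open>(1 - z) / 2\<close>, the sum of the two differences of
  digamma values is \<open>pi\<close> times \<open>cot + tan\<close> of \<open>pi z / 2\<close>, hence twice the right-hand side.
  In these differences the logarithms of the defining limit of the digamma function cancel and
  only simple fractions remain.  Cutting the sum after an even number of terms makes every
  partial sum agree with a partial sum of those fractions up to one boundary term, which tends
  to zero.\<close>
lemma csc_partial_fractions:
  fixes z :: complex assumes z: "z \<notin> \<int>"
  shows "(\<lambda>m. 1 / z - (\<Sum>k<2*m. (-1) ^ k * (2 * z / (z\<^sup>2 - (of_nat k + 1)\<^sup>2))))
           \<longlonglongrightarrow> of_real pi / sin (of_real pi * z)"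
proof -
  have z0: "z \<noteq> 0" using z by auto
  have zn: "z + of_int n \<noteq> 0" for n
  proof
    assume "z + of_int n = 0"
    hence "z = of_int (- n)" by (simp add: add_eq_0_iff2)
    thus False using z by (metis Ints_of_int)
  qed
  have zn1: "z + of_nat n \<noteq> 0" "z - of_nat n \<noteq> 0" for n
    using zn[of "int n"] zn[of "- int n"] by auto
  have sin0: "sin (of_real pi * z) \<noteq> 0" using z by (subst sin_eq_0) auto
  have half: "z / 2 \<notin> \<int>" "(1 - z) / 2 \<notin> \<int>"
  proof -
    show "z / 2 \<notin> \<int>" using Ints_mult[of 2 "z/2"] z by auto
    show "(1 - z) / 2 \<notin> \<int>"
    proof
      assume "(1 - z) / 2 \<in> \<int>"
      hence "1 - 2 * ((1 - z) / 2) \<in> \<int>" by (intro Ints_diff Ints_mult) auto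
      moreover have "1 - 2 * ((1 - z) / 2) = z" by (simp add: field_simps)
      ultimately show False using z by metis
    qed
  qed
  let ?P = "\<lambda>z m. of_real (ln (real m)) - (\<Sum>k<m. inverse (z + of_nat k)) :: complex"
  have lim: "(\<lambda>m. (?P (1 - z / 2) m - ?P (z / 2) m) + (?P ((1 + z) / 2) m - ?P ((1 - z) / 2) m))
      \<longlonglongrightarrow> (Digamma (1 - z / 2) - Digamma (z / 2)) + (Digamma ((1 + z) / 2) - Digamma ((1 - z) / 2))"
    using half zn1[of 1] zn1[of 2] z0 by (intro tendsto_intros Digamma_LIMSEQ) (auto simp: field_simps)
  have "Digamma (1 - z / 2) - Digamma (z / 2) = of_real pi * cot (of_real pi * z / 2)"
    using Digamma_reflection[OF half(1)] by simp
  moreover have "Digamma ((1 + z) / 2) - Digamma ((1 - z) / 2) = of_real pi * tan (of_real pi * z / 2)"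
  proof -
    have "1 - (1 - z) / 2 = (1 + z) / 2" by (simp add: field_simps)
    hence "Digamma ((1 + z) / 2) - Digamma ((1 - z) / 2) = of_real pi * cot (of_real pi * ((1 - z) / 2))"
      using Digamma_reflection[OF half(2)] by metis
    also have "of_real pi * ((1 - z) / 2) = of_real pi / 2 - of_real pi * z / 2"
      by (simp add: field_simps)
    also have "cot \<dots> = tan (of_real pi * z / 2)"
      using sin_of_real[of "pi / 2", where 'a = complex] cos_of_real[of "pi / 2", where 'a = complex]
      by (simp add: cot_def tan_def sin_diff cos_diff)
    finally show ?thesis .
  qed
  ultimately have val: "(Digamma (1 - z / 2) - Digamma (z / 2)) + (Digamma ((1 + z) / 2) - Digamma ((1 - z) / 2))
      = 2 * (of_real pi / sin (of_real pi * z))"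
    using cot_half_add_tan_half[OF sin0] by (simp flip: distrib_left)
  define T where "T k = 2 * z / (z\<^sup>2 - (of_nat k + 1)\<^sup>2)" for k :: nat
  \<comment> \<open>In the sum over \<open>T\<close> the fraction of \<open>z + 2 m\<close> comes together with that of \<open>z - 2 m\<close>; on the left it
    comes one step later, hence the last term.\<close>
  have sum: "(?P (1 - z / 2) m - ?P (z / 2) m) + (?P ((1 + z) / 2) m - ?P ((1 - z) / 2) m) =
      2 * (1 / z - (\<Sum>k<2*m. (-1) ^ k * T k) - 1 / (z + of_nat (2 * m)))" for m
  proof (induction m)
    case 0 show ?case by simp
  next
    case (Suc m)
    define a b c where "a = 1 / (z + of_nat (2 * m + 1))" and "b = 1 / (z - of_nat (2 * m + 1))"
      and "c = 1 / (z - of_nat (2 * m + 2))"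
    have pf: "T k = 1 / (z + of_nat (k + 1)) + 1 / (z - of_nat (k + 1))" for k
      using zn1[of "k + 1"] square_diff_square_factored[of z "of_nat (k + 1)"]
      by (simp add: T_def power2_eq_square add_frac_eq algebra_simps)
    have sumT: "(\<Sum>k<2 * Suc m. (-1) ^ k * T k) =
        (\<Sum>k<2*m. (-1) ^ k * T k) + (a + b) - (1 / (z + of_nat (2 * Suc m)) + c)"
      by (simp add: pf a_def b_def c_def add_ac)
    have e: "inverse (1 - z / 2 + of_nat m) = - 2 * c"
            "inverse (z / 2 + of_nat m) = 2 * (1 / (z + of_nat (2 * m)))"
            "inverse ((1 + z) / 2 + of_nat m) = 2 * a"
            "inverse ((1 - z) / 2 + of_nat m) = - 2 * b"
      unfolding a_def b_def c_def
      using zn1[of "2*m+2"] zn1[of "2*m+1"] zn1[of "2*m"]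
      by (simp_all add: divide_simps) (auto simp: algebra_simps)
    have step: "(\<Sum>k<Suc m. inverse (w + of_nat k)) =
        (\<Sum>k<m. inverse (w + of_nat k)) + inverse (w + of_nat m)" for w :: complex
      by simp
    show ?case
      using Suc.IH unfolding sumT step e by (simp only: ring_distribs) (simp add: algebra_simps)
  qed
  have "(\<lambda>m. 1 / (z + of_nat (2 * m))) \<longlonglongrightarrow> 0"
  proof -
    have "filterlim (\<lambda>m. z + of_nat m) at_infinity sequentially"
      by (intro tendsto_add_filterlim_at_infinity[OF tendsto_const] tendsto_of_nat)
    hence "filterlim (\<lambda>m. z + of_nat (2 * m)) at_infinity sequentially"
      by (rule filterlim_compose) (rule mult_nat_left_at_top, simp)
    from tendsto_inverse_0[THEN filterlim_compose, OF this] show ?thesis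
      by (simp add: inverse_eq_divide)
  qed
  moreover have "(\<lambda>m. 1 / z - (\<Sum>k<2*m. (-1) ^ k * (2 * z / (z\<^sup>2 - (of_nat k + 1)\<^sup>2))) - 1 / (z + of_nat (2 * m)))
     \<longlonglongrightarrow> of_real pi / sin (of_real pi * z)"
    using lim unfolding sum val T_def by (subst (asm) tendsto_mult_left_iff) auto
  ultimately show ?thesis by (auto dest: tendsto_add)
qed

text \<open>The cosecant expansion on the imaginary axis, at \<open>z = 2 i v / pi\<close>.  The general term is the
  Laplace integral of \<open>sin (v x)\<close> at the rate \<open>(k + 1) pi / 2\<close>, which is how the expansion is used.\<close>
lemma csch_partial_fractions:
  fixes v :: real assumes v: "v \<noteq> 0"
  shows "(\<lambda>m. 2 * (\<Sum>k<2*m. (-1) ^ k * (v / (v\<^sup>2 + ((real k + 1) * (pi / 2))\<^sup>2))))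
           \<longlonglongrightarrow> 1 / v - 2 / sinh (2 * v)"
proof -
  define z where "z = \<i> * of_real (2 * v / pi)"
  have z: "z \<notin> \<int>"
  proof
    assume "z \<in> \<int>"
    then obtain n where "z = of_int n" by (elim Ints_cases)
    hence "Im z = 0" by simp
    thus False using v by (simp add: z_def)
  qed
  have "sinh (of_real (2 * v) :: complex) = of_real (sinh (2 * v))"
    unfolding sinh_field_def by (simp flip: exp_of_real)
  hence sinz: "sin (of_real pi * z) = \<i> * of_real (sinh (2 * v))"
    using sinh_conv_sin[of "of_real (2 * v) :: complex"]
    by (simp add: z_def complex_eq_iff mult_ac)
  have term_eq: "2 * z / (z\<^sup>2 - (of_nat k + 1)\<^sup>2) =
      - \<i> * of_real (pi * (v / (v\<^sup>2 + ((real k + 1) * (pi / 2))\<^sup>2)))" for k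
  proof -
    have "z\<^sup>2 = of_real (- (4 / pi\<^sup>2) * v\<^sup>2)"
      by (simp add: z_def power_mult_distrib power_divide)
    moreover have "(real k + 1)\<^sup>2 = (4 / pi\<^sup>2) * ((real k + 1) * (pi / 2))\<^sup>2"
      by (simp add: power_mult_distrib power_divide)
    moreover have "(of_nat k + 1)\<^sup>2 = complex_of_real ((real k + 1)\<^sup>2)" by simp
    ultimately have "z\<^sup>2 - (of_nat k + 1)\<^sup>2 = of_real (- (4 / pi\<^sup>2) * (v\<^sup>2 + ((real k + 1) * (pi / 2))\<^sup>2))"
      by (simp only: distrib_left of_real_diff[symmetric] diff_conv_add_uminus of_real_minus[symmetric]
            of_real_add[symmetric] mult_minus_left)
    moreover have "2 * z = - \<i> * of_real (- (4 / pi\<^sup>2) * (pi * v))"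
      by (simp add: z_def power2_eq_square)
    ultimately have "2 * z / (z\<^sup>2 - (of_nat k + 1)\<^sup>2) = (- \<i> * of_real (- (4 / pi\<^sup>2) * (pi * v))) /
        of_real (- (4 / pi\<^sup>2) * (v\<^sup>2 + ((real k + 1) * (pi / 2))\<^sup>2))"
      by (simp only:)
    also have "\<dots> = - \<i> * of_real ((- (4 / pi\<^sup>2) * (pi * v)) /
        (- (4 / pi\<^sup>2) * (v\<^sup>2 + ((real k + 1) * (pi / 2))\<^sup>2)))"
      by (simp only: of_real_divide times_divide_eq_right)
    also have "(- (4 / pi\<^sup>2) * (pi * v)) / (- (4 / pi\<^sup>2) * (v\<^sup>2 + ((real k + 1) * (pi / 2))\<^sup>2))
        = pi * (v / (v\<^sup>2 + ((real k + 1) * (pi / 2))\<^sup>2))"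
      by (subst mult_divide_mult_cancel_left) auto
    finally show ?thesis .
  qed
  have "(\<lambda>m. (\<i> / of_real pi) * (1 / z - (\<Sum>k<2*m. (-1) ^ k * (2 * z / (z\<^sup>2 - (of_nat k + 1)\<^sup>2)))))
           \<longlonglongrightarrow> (\<i> / of_real pi) * (of_real pi / sin (of_real pi * z))"
    by (intro tendsto_mult tendsto_const csc_partial_fractions z)
  also have "(\<i> / of_real pi) * (of_real pi / sin (of_real pi * z)) = of_real (1 / sinh (2 * v))"
    by (simp add: sinz)
  also have "(\<lambda>m. (\<i> / of_real pi) * (1 / z - (\<Sum>k<2*m. (-1) ^ k * (2 * z / (z\<^sup>2 - (of_nat k + 1)\<^sup>2))))) =
     (\<lambda>m. of_real (1 / (2 * v) - (\<Sum>k<2*m. (-1) ^ k * (v / (v\<^sup>2 + ((real k + 1) * (pi / 2))\<^sup>2)))))"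
    (is "?L = ?R")
  proof
    fix m
    have "?L m = (\<i> / of_real pi) * (1 / z) - (\<Sum>k<2*m. (-1) ^ k * ((\<i> / of_real pi) * (2 * z / (z\<^sup>2 - (of_nat k + 1)\<^sup>2))))"
      by (simp add: right_diff_distrib sum_distrib_left mult_ac)
    also have "(\<i> / of_real pi) * (1 / z) = of_real (1 / (2 * v))"
      by (simp add: z_def)
    also have "(\<lambda>k. (\<i> / of_real pi) * (2 * z / (z\<^sup>2 - (of_nat k + 1)\<^sup>2))) =
        (\<lambda>k::nat. of_real (v / (v\<^sup>2 + ((real k + 1) * (pi / 2))\<^sup>2)))"
      unfolding term_eq by (auto simp del: of_real_add of_real_power)
    finally show "?L m = ?R m" by simp
  qed
  finally have "(\<lambda>m. 1 / (2 * v) - (\<Sum>k<2*m. (-1) ^ k * (v / (v\<^sup>2 + ((real k + 1) * (pi / 2))\<^sup>2))))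
      \<longlonglongrightarrow> 1 / sinh (2 * v)"
    by (simp only: tendsto_of_real_iff)
  from tendsto_mult[OF tendsto_const[of "2"] tendsto_diff[OF tendsto_const[of "1 / (2 * v)"] this]]
  show ?thesis by (simp add: right_diff_distrib)
qed


section \<open>The sine transform of the Fermi weight\<close>

text \<open>Twice the Fermi-Dirac distribution; the weight \<open>exp (- pi x / 4) / cosh (pi x / 4)\<close> in
  another form, one that expands in a geometric series.\<close>
definition fermi :: "real \<Rightarrow> real" where
  "fermi x = 2 / (1 + exp (pi * x / 2))"

text \<open>An odd function with a removable singularity; \<open>0\<close> is its continuous value there, and also the
  value of the sine transform below at \<open>0\<close>.\<close>
definition csch_defect :: "real \<Rightarrow> real" where
  "csch_defect v = (if v = 0 then 0 else 1 / v - 2 / sinh (2 * v))"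

lemma fermi_pos: "fermi x > 0"
  by (simp add: fermi_def add_pos_pos)

lemma fermi_measurable [measurable]: "fermi \<in> borel_measurable borel"
  unfolding fermi_def by measurable

lemma csch_defect_measurable [measurable]: "csch_defect \<in> borel_measurable borel"
  unfolding csch_defect_def sinh_field_def by measurable

lemma fermi_eq_geometric: "fermi x = 2 * exp (- (pi / 2) * x) / (1 + exp (- (pi / 2) * x))"
proof -
  have "2 / (1 + e) = 2 * (1 / e) / (1 + 1 / e)" if "e > 0" for e :: real
    using that by (simp add: field_simps)
  from this[of "exp (pi * x / 2)"] show ?thesis
    by (simp add: fermi_def exp_minus inverse_eq_divide)
qed

lemma fermi_le_exp: "fermi x \<le> 2 * exp (- (pi / 2) * x)"
  by (simp add: fermi_eq_geometric divide_le_eq add_pos_pos)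

lemma set_integrable_fermi: "set_integrable lborel {0<..} fermi"
proof (rule set_integrable_bound)
  show "set_integrable lborel {0<..} (\<lambda>x. 2 * exp (- (pi / 2) * x))"
    using set_integrable_exp_Ioi[of "pi / 2"] by simp
  show "AE x in lborel. x \<in> {0<..} \<longrightarrow> norm (fermi x) \<le> norm (2 * exp (- (pi / 2) * x))"
    using fermi_le_exp fermi_pos by (auto intro!: AE_I2 simp: abs_of_pos)
qed (auto simp: set_borel_measurable_def)

text \<open>Expanding the weight in the alternating geometric series of \<open>exp (- pi x / 2)\<close> and
  integrating termwise gives the partial fractions of the hyperbolic cosecant.  The partial sums
  with an even number of terms stay between \<open>0\<close> and the weight, so dominated convergence applies
  to them.\<close>
lemma fermi_sine_transform:
  "(LBINT x:{0<..}. fermi x * sin (v * x)) = csch_defect v"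
proof (cases "v = 0")
  case True thus ?thesis by (simp add: csch_defect_def)
next
  case False
  define s where "s m x = (\<Sum>k<2*m. (-1) ^ k * (2 * exp (- ((real k + 1) * (pi / 2)) * x)))" for m :: nat and x
  have s_closed: "s m x = fermi x * (1 - exp (- (pi / 2) * x) ^ (2 * m))" for m x
  proof -
    let ?q = "exp (- (pi / 2) * x)"
    have "exp (- ((real k + 1) * (pi / 2)) * x) = ?q * ?q ^ k" for k
      by (simp add: field_simps flip: exp_of_nat_mult exp_add)
    hence "s m x = (\<Sum>k<2*m. 2 * ?q * (- ?q) ^ k)"
      unfolding s_def by (intro sum.cong refl) (subst power_minus, simp)
    also have "\<dots> = 2 * ?q * (\<Sum>k<2*m. (- ?q) ^ k)" by (simp add: sum_distrib_left)
    also have "(\<Sum>k<2*m. (- ?q) ^ k) = (1 - (- ?q) ^ (2 * m)) / (1 + ?q)"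
    proof -
      have "?q > 0" by simp
      hence "- ?q \<noteq> 1" by linarith
      thus ?thesis by (simp only: sum_gp_strict if_False diff_minus_eq_add)
    qed
    finally show ?thesis by (simp add: fermi_eq_geometric power_mult)
  qed
  let ?f = "\<lambda>m x. indicator {0<..} x *\<^sub>R (s m x * sin (v * x))"
  have "(\<lambda>m. LBINT x. ?f m x) \<longlonglongrightarrow> (LBINT x. indicator {0<..} x *\<^sub>R (fermi x * sin (v * x)))"
  proof (rule integral_dominated_convergence)
    show "integrable lborel (\<lambda>x. indicator {0<..} x *\<^sub>R fermi x)"
      using set_integrable_fermi by (simp add: set_integrable_def)
    show "AE x in lborel. (\<lambda>m. ?f m x) \<longlonglongrightarrow> indicator {0<..} x *\<^sub>R (fermi x * sin (v * x))"
    proof (intro AE_I2)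
      fix x :: real
      show "(\<lambda>m. ?f m x) \<longlonglongrightarrow> indicator {0<..} x *\<^sub>R (fermi x * sin (v * x))"
      proof (cases "x > 0")
        case True
        hence "(\<lambda>m. (exp (- (pi / 2) * x) ^ 2) ^ m) \<longlonglongrightarrow> 0"
          by (intro LIMSEQ_realpow_zero) (auto simp: power_less_one_iff)
        from tendsto_diff[OF tendsto_const[of 1] this]
        have "(\<lambda>m. fermi x * (1 - exp (- (pi / 2) * x) ^ (2 * m)) * sin (v * x)) \<longlonglongrightarrow> fermi x * 1 * sin (v * x)"
          by (intro tendsto_intros) (simp add: power_mult)
        thus ?thesis using True by (simp add: s_closed)
      qed auto
    qed
    show "AE x in lborel. norm (?f m x) \<le> indicator {0<..} x *\<^sub>R fermi x" for m
    proof (intro AE_I2)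
      fix x :: real
      have "\<bar>fermi x * (1 - exp (- (pi / 2) * x) ^ (2 * m)) * sin (v * x)\<bar> \<le> fermi x * 1 * 1" if "x > 0"
        unfolding abs_mult using that fermi_pos[of x]
        by (intro mult_mono) (auto simp: power_le_one)
      thus "norm (?f m x) \<le> indicator {0<..} x *\<^sub>R fermi x"
        by (auto simp: s_closed indicator_def)
    qed
  qed (auto simp: s_closed)
  moreover have "(LBINT x. ?f m x) = 2 * (\<Sum>k<2*m. (-1) ^ k * (v / (v\<^sup>2 + ((real k + 1) * (pi / 2))\<^sup>2)))" for m
  proof -
    let ?g = "\<lambda>k x. indicator {0<..} x *\<^sub>R (exp (- ((real k + 1) * (pi / 2)) * x) * sin (v * x))"
    have "(LBINT x. ?f m x) = (LBINT x. (\<Sum>k<2*m. (-1) ^ k * 2 * ?g k x))"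
      by (simp add: s_def sum_distrib_right sum_distrib_left mult_ac)
    also have "\<dots> = (\<Sum>k<2*m. (-1) ^ k * 2 * (LBINT x. ?g k x))"
    proof (subst Bochner_Integration.integral_sum)
      show "integrable lborel (\<lambda>x. (-1) ^ k * 2 * ?g k x)" for k
        using set_integrable_exp_sin_Ioi[of "(real k + 1) * (pi / 2)" v]
        by (intro integrable_mult_right) (simp add: set_integrable_def)
    qed simp
    also have "\<dots> = (\<Sum>k<2*m. (-1) ^ k * 2 * (v / (v\<^sup>2 + ((real k + 1) * (pi / 2))\<^sup>2)))"
      using set_integral_exp_sin_Ioi[of "(real k + 1) * (pi / 2)" v for k]
      by (simp add: set_lebesgue_integral_def)
    finally show ?thesis by (simp add: sum_distrib_left mult_ac)
  qed
  ultimately show ?thesis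
    using csch_partial_fractions[OF False] False
    by (simp add: csch_defect_def set_lebesgue_integral_def LIMSEQ_unique)
qed

text \<open>The representation as a sine transform bounds the function on the whole line at once.  The bound
  gives the integrability of \<open>exp (- t v) * csch_defect v\<close>, the decay of its integral as \<open>t\<close> grows,
  and the smallness of its integral over a short window around \<open>0\<close>.\<close>
lemma csch_defect_bound: "\<bar>csch_defect v\<bar> \<le> (LBINT x:{0<..}. fermi x)"
proof -
  have "norm (LBINT x. indicator {0<..} x *\<^sub>R (fermi x * sin (v * x))) \<le> (LBINT x. indicator {0<..} x *\<^sub>R fermi x)"
  proof (rule Bochner_Integration.integral_norm_bound_integral)
    show "integrable lborel (\<lambda>x. indicator {0<..} x *\<^sub>R fermi x)"
      using set_integrable_fermi by (simp add: set_integrable_def)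
    thus "integrable lborel (\<lambda>x. indicator {0<..} x *\<^sub>R (fermi x * sin (v * x)))"
      by (rule Bochner_Integration.integrable_bound)
         (auto simp: indicator_def abs_mult abs_of_pos[OF fermi_pos] intro!: AE_I2 mult_left_le fermi_pos[THEN less_imp_le])
  qed (auto simp: indicator_def abs_mult abs_of_pos[OF fermi_pos] intro!: mult_left_le fermi_pos[THEN less_imp_le])
  thus ?thesis using fermi_sine_transform[of v] by (simp add: set_lebesgue_integral_def)
qed

lemma integrable_pair_mult:
  fixes f :: "'a \<Rightarrow> real" and g :: "'b \<Rightarrow> real"
  assumes "pair_sigma_finite M N" "integrable M f" "integrable N g"
  shows "integrable (M \<Otimes>\<^sub>M N) (\<lambda>(x, y). f x * g y)"
proof -
  interpret pair_sigma_finite M N by fact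
  have [measurable]: "f \<in> borel_measurable M" "g \<in> borel_measurable N" using assms by auto
  show ?thesis
  proof (rule Fubini_integrable)
    show "integrable M (\<lambda>x. \<integral>y. norm (case (x, y) of (x, y) \<Rightarrow> f x * g y) \<partial>N)"
      using assms by (simp add: abs_mult)
    show "AE x in M. integrable N (\<lambda>y. case (x, y) of (x, y) \<Rightarrow> f x * g y)"
      using assms by simp
  qed measurable
qed

section \<open>Exchanging the sine and the Laplace transform\<close>

text \<open>The Poisson-type kernel \<open>x / (x^2 + t^2)\<close> is the Laplace integral of \<open>sin (x u)\<close>.  After
  Fubini, the product \<open>cos (s x) sin (x u)\<close> splits into two sines and the inner integral is a sum of
  two sine transforms of the weight.  The case \<open>s = 0\<close> gives the digamma function, the case
  \<open>t = 1\<close> the characteristic function.\<close>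
lemma fermi_poisson_transform:
  fixes s t :: real assumes t: "t > 0"
  shows "(LBINT x:{0<..}. fermi x * cos (s * x) * (x / (x\<^sup>2 + t\<^sup>2))) =
         (LBINT u:{0<..}. exp (- t * u) * ((csch_defect (u + s) + csch_defect (u - s)) / 2))"
proof -
  have P: "pair_sigma_finite lborel (lborel :: real measure)"
    by (simp add: pair_sigma_finite_def sigma_finite_lborel)
  let ?a = "\<lambda>x. indicator {0<..} x *\<^sub>R fermi x"
  let ?b = "\<lambda>u. indicator {0<..} u *\<^sub>R exp (- t * u) :: real"
  let ?f = "\<lambda>x u. ?a x * ?b u * (cos (s * x) * sin (x * u))"
  have fa: "integrable lborel ?a" "integrable lborel ?b"
    using set_integrable_fermi set_integrable_exp_Ioi[OF t] by (simp_all add: set_integrable_def)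
  have int: "integrable (lborel \<Otimes>\<^sub>M lborel) (\<lambda>(x, u). ?f x u)"
  proof (rule Bochner_Integration.integrable_bound[OF integrable_pair_mult[OF P fa]])
    have "\<bar>?a x * ?b u * (cos (s * x) * sin (x * u))\<bar> \<le> \<bar>?a x * ?b u\<bar>" for x u
    proof -
      have "\<bar>cos (s * x) * sin (x * u)\<bar> \<le> 1 * 1" unfolding abs_mult by (intro mult_mono) auto
      thus ?thesis by (subst abs_mult) (auto intro!: mult_left_le)
    qed
    thus "AE p in lborel \<Otimes>\<^sub>M lborel. norm (case p of (x, u) \<Rightarrow> ?f x u) \<le> norm (case p of (x, u) \<Rightarrow> ?a x * ?b u)"
      by (intro AE_I2) auto
  qed measurable
  have swap: "(LBINT x. LBINT u. ?f x u) = (LBINT u. LBINT x. ?f x u)"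
    using lborel_pair.integral_fst[OF int] lborel_pair.integral_snd[OF int] by simp
  have inner_u: "(LBINT u. ?f x u) = indicator {0<..} x *\<^sub>R (fermi x * cos (s * x) * (x / (x\<^sup>2 + t\<^sup>2)))" for x
  proof -
    have "(LBINT u. ?f x u) = ?a x * cos (s * x) * (LBINT u. indicator {0<..} u *\<^sub>R (exp (- t * u) * sin (x * u)))"
      by (subst integral_mult_right_zero[symmetric]) (simp add: mult_ac)
    thus ?thesis using set_integral_exp_sin_Ioi[OF t, of x]
      by (simp add: set_lebesgue_integral_def)
  qed
  have inner_x: "(LBINT x. ?f x u) = indicator {0<..} u *\<^sub>R (exp (- t * u) * ((csch_defect (u + s) + csch_defect (u - s)) / 2))" for u
  proof -
    have int: "set_integrable lborel {0<..} (\<lambda>x. fermi x * sin (v * x))" for v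
      by (rule set_integrable_bound[OF set_integrable_fermi])
         (auto simp: set_borel_measurable_def abs_mult abs_of_pos[OF fermi_pos] intro!: AE_I2 mult_left_le fermi_pos[THEN less_imp_le])
    have trig: "cos (s * x) * sin (x * u) = (sin ((u + s) * x) + sin ((u - s) * x)) / 2" for x
      using sin_times_cos[of "x * u" "s * x"] by (simp add: algebra_simps)
    have "(LBINT x. ?f x u) = (LBINT x. ?b u / 2 *
            (indicator {0<..} x *\<^sub>R (fermi x * sin ((u + s) * x) + fermi x * sin ((u - s) * x))))"
      by (intro Bochner_Integration.integral_cong refl)
         (simp add: trig flip: distrib_left)
    also have "\<dots> = ?b u / 2 * (LBINT x:{0<..}. fermi x * sin ((u + s) * x) + fermi x * sin ((u - s) * x))"
      by (simp add: set_lebesgue_integral_def)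
    also have "\<dots> = ?b u / 2 * (csch_defect (u + s) + csch_defect (u - s))"
      by (simp add: set_integral_add(2)[OF int int] fermi_sine_transform)
    finally show ?thesis by simp
  qed
  show ?thesis
    using swap unfolding inner_u inner_x set_lebesgue_integral_def .
qed


section \<open>The Laplace transform as a digamma value\<close>

text \<open>Both facts come from integrating \<open>exp (- y v)\<close> over \<open>a \<le> y \<le> b\<close> and \<open>v > 0\<close> in the two
  orders.\<close>
lemma Frullani_exp:
  fixes a b :: real assumes ab: "0 < a" "a \<le> b"
  shows "set_integrable lborel {0<..} (\<lambda>v. (exp (- a * v) - exp (- b * v)) / v)"
    and "(LBINT v:{0<..}. (exp (- a * v) - exp (- b * v)) / v) = ln (b / a)"
proof -
  have P: "pair_sigma_finite lborel (lborel :: real measure)"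
    by (simp add: pair_sigma_finite_def sigma_finite_lborel)
  let ?f = "\<lambda>y v. indicator {a..b} y * (indicator {0<..} v * exp (- y * v)) :: real"
  have int: "integrable (lborel \<Otimes>\<^sub>M lborel) (\<lambda>(y, v). ?f y v)"
  proof (rule Bochner_Integration.integrable_bound[OF integrable_pair_mult[OF P]])
    show "integrable lborel (indicator {a..b} :: real \<Rightarrow> real)"
      by (intro integrable_real_indicator) (auto simp: emeasure_lborel_Icc_eq)
    show "integrable lborel (\<lambda>v. indicator {0<..} v * exp (- a * v))"
      using set_integrable_exp_Ioi[OF ab(1)] by (simp add: set_integrable_def)
    show "AE p in lborel \<Otimes>\<^sub>M lborel. norm (case p of (y, v) \<Rightarrow> ?f y v) \<le>
        norm (case p of (y, v) \<Rightarrow> indicator {a..b} y * (indicator {0<..} v * exp (- a * v)))"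
      by (intro AE_I2) (auto simp: indicator_def)
  qed measurable
  have inner_y: "(LBINT y. ?f y v) = indicator {0<..} v *\<^sub>R ((exp (- a * v) - exp (- b * v)) / v)" for v
  proof (cases "v > 0")
    case True
    have "(LBINT y. exp (- y * v) * indicator {a..b} y) = - exp (- b * v) / v - (- exp (- a * v) / v)"
      using True ab by (intro integral_FTC_Icc_real) (auto intro!: derivative_eq_intros)
    thus ?thesis using True by (simp add: mult.commute diff_divide_distrib)
  qed auto
  have inner_v: "(LBINT v. ?f y v) = 1 / y * indicator {a..b} y" for y
  proof (cases "y \<in> {a..b}")
    case True
    thus ?thesis using ab set_integral_exp_Ioi[of y] by (simp add: set_lebesgue_integral_def)
  qed auto
  show "set_integrable lborel {0<..} (\<lambda>v. (exp (- a * v) - exp (- b * v)) / v)"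
    using lborel_pair.integrable_snd[OF int] by (simp only: inner_y set_integrable_def)
  have "(LBINT v. LBINT y. ?f y v) = (LBINT y. LBINT v. ?f y v)"
    using lborel_pair.integral_fst[OF int] lborel_pair.integral_snd[OF int] by simp
  also have "\<dots> = (LBINT y. 1 / y * indicator {a..b} y)" by (simp only: inner_v)
  also have "\<dots> = ln b - ln a"
    using ab by (intro integral_FTC_Icc_real) (auto intro!: derivative_eq_intros)
  finally show "(LBINT v:{0<..}. (exp (- a * v) - exp (- b * v)) / v) = ln (b / a)"
    unfolding inner_y set_lebesgue_integral_def using ab by (simp only: ln_divide_pos)
qed

lemma set_integrable_Ioi_shift:
  fixes f :: "real \<Rightarrow> real"
  shows "set_integrable lborel {a<..} f \<longleftrightarrow> set_integrable lborel {0<..} (\<lambda>u. f (u + a))"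
proof -
  have "indicator {a<..} (a + u) = (indicator {0<..} u :: real)" for u :: real
    by (auto simp: indicator_def)
  thus ?thesis
    using lborel_integrable_real_affine_iff[of 1 "\<lambda>v. indicator {a<..} v *\<^sub>R f v" a]
    by (simp add: set_integrable_def add.commute)
qed

lemma set_integral_Ioi_shift:
  fixes f :: "real \<Rightarrow> real"
  shows "(LBINT v:{a<..}. f v) = (LBINT u:{0<..}. f (u + a))"
proof -
  have "indicator {a<..} (a + u) = (indicator {0<..} u :: real)" for u :: real
    by (auto simp: indicator_def)
  thus ?thesis
    using lborel_integral_real_affine[of 1 "\<lambda>v. indicator {a<..} v *\<^sub>R f v" a]
    by (simp add: set_lebesgue_integral_def add.commute)
qed

lemma set_integrable_exp_greaterThan:
  fixes a t :: real assumes "t > 0"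
  shows "set_integrable lborel {a<..} (\<lambda>u. exp (- t * u))"
proof -
  have eq: "exp (- t * (u + a)) = exp (- t * u) * exp (- t * a)" for u
    by (simp only: distrib_left exp_add)
  have "set_integrable lborel {0<..} (\<lambda>u. exp (- t * u) * exp (- t * a))"
    by (rule set_integrable_mult_left) (rule set_integrable_exp_Ioi[OF assms])
  thus ?thesis by (subst set_integrable_Ioi_shift) (simp only: eq)
qed

lemma set_integrable_exp_csch_defect:
  fixes a t :: real assumes t: "t > 0"
  shows "set_integrable lborel {a<..} (\<lambda>v. exp (- t * v) * csch_defect v)"
proof (rule set_integrable_bound)
  show "set_integrable lborel {a<..} (\<lambda>v. exp (- t * v) * (LBINT x:{0<..}. fermi x))"
    using set_integrable_exp_greaterThan[OF t] by simp
  have "norm (exp (- t * v) * csch_defect v) \<le> norm (exp (- t * v) * (LBINT x:{0<..}. fermi x))" for v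
    unfolding real_norm_def abs_mult
    by (intro mult_left_mono order_trans[OF csch_defect_bound abs_ge_self] abs_ge_zero)
  thus "AE v in lborel. v \<in> {a<..} \<longrightarrow> norm (exp (- t * v) * csch_defect v)
      \<le> norm (exp (- t * v) * (LBINT x:{0<..}. fermi x))"
    by blast
  have "(\<lambda>v. indicator {a<..} v *\<^sub>R (exp (- t * v) * csch_defect v)) \<in> borel_measurable lborel"
    by measurable
  thus "set_borel_measurable lborel {a<..} (\<lambda>v. exp (- t * v) * csch_defect v)"
    by (simp only: set_borel_measurable_def)
qed

definition csch_laplace :: "real \<Rightarrow> real" where
  "csch_laplace t = (LBINT v:{0<..}. exp (- t * v) * csch_defect v)"

text \<open>The shift by \<open>4\<close> multiplies the integrand by \<open>1 - exp (- 4 v)\<close>, which cancels the denominator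
  of the hyperbolic cosecant: what is left is a Frullani integral and an exponential.\<close>
lemma csch_laplace_diff:
  assumes t: "t > 0"
  shows "csch_laplace t - csch_laplace (t + 4) = ln ((t + 4) / t) - 4 / (t + 2)"
proof -
  have eq: "exp (- t * v) * csch_defect v - exp (- (t + 4) * v) * csch_defect v =
      (exp (- t * v) - exp (- (t + 4) * v)) / v - 4 * exp (- (t + 2) * v)" if v: "v > 0" for v
  proof -
    have "sinh (2 * v) \<noteq> 0" using v by simp
    moreover have "exp (- t * v) - exp (- (t + 4) * v) = 2 * exp (- (t + 2) * v) * sinh (2 * v)"
      by (simp add: sinh_field_def algebra_simps flip: exp_add)
    ultimately have "(exp (- t * v) - exp (- (t + 4) * v)) * (2 / sinh (2 * v)) = 4 * exp (- (t + 2) * v)"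
      by simp
    thus ?thesis using v by (simp add: csch_defect_def algebra_simps diff_divide_distrib)
  qed
  have "csch_laplace t - csch_laplace (t + 4) =
      (LBINT v:{0<..}. exp (- t * v) * csch_defect v - exp (- (t + 4) * v) * csch_defect v)"
    unfolding csch_laplace_def
    by (rule set_integral_diff(2)[symmetric]; rule set_integrable_exp_csch_defect; use t in simp)
  also have "\<dots> = (LBINT v:{0<..}. (exp (- t * v) - exp (- (t + 4) * v)) / v - 4 * exp (- (t + 2) * v))"
    using eq by (intro set_lebesgue_integral_cong) auto
  also have "\<dots> = (LBINT v:{0<..}. (exp (- t * v) - exp (- (t + 4) * v)) / v) -
      (LBINT v:{0<..}. 4 * exp (- (t + 2) * v))"
    using t set_integrable_exp_Ioi[of "t + 2"]
    by (intro set_integral_diff(2) Frullani_exp) auto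
  also have "\<dots> = ln ((t + 4) / t) - 4 / (t + 2)"
    using t Frullani_exp(2)[of t "t + 4"] set_integral_exp_Ioi[of "t + 2"] by simp
  finally show ?thesis .
qed

lemma csch_laplace_bound:
  assumes t: "t > 0"
  shows "\<bar>csch_laplace t\<bar> \<le> (LBINT x:{0<..}. fermi x) / t"
proof -
  define K where "K = (LBINT x:{0<..}. fermi x)"
  have "norm (csch_laplace t) \<le> (LBINT v. indicator {0<..} v *\<^sub>R (exp (- t * v) * K))"
    unfolding csch_laplace_def set_lebesgue_integral_def
  proof (rule Bochner_Integration.integral_norm_bound_integral)
    show "integrable lborel (\<lambda>v. indicator {0<..} v *\<^sub>R (exp (- t * v) * csch_defect v))"
      using set_integrable_exp_csch_defect[OF t, of 0] by (simp add: set_integrable_def)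
    show "integrable lborel (\<lambda>v. indicator {0<..} v *\<^sub>R (exp (- t * v) * K))"
      using set_integrable_mult_left[OF set_integrable_exp_Ioi[OF t], of K] by (simp add: set_integrable_def)
    show "norm (indicator {0<..} v *\<^sub>R (exp (- t * v) * csch_defect v)) \<le> indicator {0<..} v *\<^sub>R (exp (- t * v) * K)" for v
      using csch_defect_bound[of v, folded K_def] by (auto simp: indicator_def abs_mult)
  qed
  also have "\<dots> = (LBINT v:{0<..}. exp (- t * v) * K)" by (simp only: set_lebesgue_integral_def)
  also have "\<dots> = 1 / t * K"
    unfolding set_integral_mult_left set_integral_exp_Ioi[OF t] ..
  finally show ?thesis by (simp add: K_def)
qed

text \<open>The right-hand side satisfies the difference equation just proved, and both sides vanish at
  infinity.  Iterating the equation \<open>n\<close> times produces exactly the partial sums of the defining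
  limit of the digamma function at \<open>t / 4 + 1 / 2\<close>.\<close>
lemma csch_laplace_eq_Digamma:
  assumes t: "t > 0"
  shows "csch_laplace t = Digamma (t / 4 + 1 / 2) - ln (t / 4)"
proof -
  \<comment> \<open>Dividing the numerator and denominator of \<open>4 / (t + 4 k + 2)\<close> by \<open>4\<close> gives the digamma terms.\<close>
  have tele: "csch_laplace t = csch_laplace (t + 4 * real n) + ln ((t + 4 * real n) / t) -
      (\<Sum>k<n. inverse (t / 4 + 1 / 2 + real k))" for n
  proof (induction n)
    case (Suc n)
    have pos: "t + 4 * real n > 0" using t by simp
    have "csch_laplace (t + 4 * real n) = csch_laplace (t + 4 * real (Suc n)) +
        (ln ((t + 4 * real (Suc n)) / (t + 4 * real n)) - 4 / (t + 4 * real n + 2))"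
      using csch_laplace_diff[OF pos] by (simp add: algebra_simps)
    moreover have "ln ((t + 4 * real (Suc n)) / (t + 4 * real n)) =
        ln ((t + 4 * real (Suc n)) / t) - ln ((t + 4 * real n) / t)"
      using t pos by (simp add: ln_div)
    moreover have "4 / (t + 4 * real n + 2) = inverse (t / 4 + 1 / 2 + real n)"
      using t by (simp add: field_simps)
    ultimately show ?case using Suc.IH by simp
  qed (use t in simp)
  define K where "K = (LBINT x:{0<..}. fermi x)"
  have "(\<lambda>n. csch_laplace (t + 4 * real n)) \<longlonglongrightarrow> 0"
  proof (rule Lim_null_comparison)
    show "\<forall>\<^sub>F n in sequentially. norm (csch_laplace (t + 4 * real n)) \<le> K / (t + 4 * real n)"
      using t csch_laplace_bound by (intro always_eventually) (auto simp: add_pos_nonneg K_def)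
    show "(\<lambda>n. K / (t + 4 * real n)) \<longlonglongrightarrow> 0"
      by real_asymp
  qed
  moreover have "(\<lambda>n. ln ((t + 4 * real n) / t) - ln (real n)) \<longlonglongrightarrow> - ln (t / 4)"
  proof -
    have "(\<lambda>n. ln ((t + 4 * real n) / t) - ln (real n)) \<longlonglongrightarrow> ln (4 / t)"
      using t by real_asymp (simp add: field_simps)
    thus ?thesis using t by (simp add: ln_div)
  qed
  moreover have "(\<lambda>n. ln (real n) - (\<Sum>k<n. inverse (t / 4 + 1 / 2 + real k))) \<longlonglongrightarrow> Digamma (t / 4 + 1 / 2)"
    using Digamma_LIMSEQ[of "t / 4 + 1 / 2"] t by simp
  ultimately have "(\<lambda>n. csch_laplace (t + 4 * real n) + (ln ((t + 4 * real n) / t) - ln (real n)) +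
      (ln (real n) - (\<Sum>k<n. inverse (t / 4 + 1 / 2 + real k)))) \<longlonglongrightarrow> 0 + - ln (t / 4) + Digamma (t / 4 + 1 / 2)"
    by (intro tendsto_add)
  moreover have "csch_laplace (t + 4 * real n) + (ln ((t + 4 * real n) / t) - ln (real n)) +
      (ln (real n) - (\<Sum>k<n. inverse (t / 4 + 1 / 2 + real k))) = csch_laplace t" for n
    using tele[of n] by simp
  ultimately have "(\<lambda>n::nat. csch_laplace t) \<longlonglongrightarrow> 0 + - ln (t / 4) + Digamma (t / 4 + 1 / 2)"
    by (simp only:)
  thus ?thesis by (simp add: LIMSEQ_const_iff)
qed

text \<open>The terms of the limits at \<open>z\<close> and \<open>z + 1 / 2\<close> interlace to the first \<open>2 m\<close> terms of the limit at
  \<open>2 z\<close>; the logarithms differ by \<open>2 ln 2\<close>.\<close>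
lemma Digamma_duplication:
  fixes z :: real assumes z: "z > 0"
  shows "Digamma z + Digamma (z + 1 / 2) = 2 * Digamma (2 * z) - 2 * ln 2"
proof -
  let ?P = "\<lambda>z m. ln (real m) - (\<Sum>k<m. inverse (z + real k))"
  have P: "?P z \<longlonglongrightarrow> Digamma z" if "z > 0" for z
    using Digamma_LIMSEQ[of z] that by simp
  have P2: "(\<lambda>m. ?P (2 * z) (2 * m)) \<longlonglongrightarrow> Digamma (2 * z)"
    using P[of "2 * z"] z by (intro filterlim_compose[OF P] mult_nat_left_at_top) auto
  have sum: "(\<Sum>k<m. inverse (z + real k)) + (\<Sum>k<m. inverse (z + 1 / 2 + real k)) =
      2 * (\<Sum>k<2*m. inverse (2 * z + real k))" for m
  proof (induction m)
    case (Suc m)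
    have "inverse (z + real m) = 2 * inverse (2 * z + real (2 * m))"
      "inverse (z + 1 / 2 + real m) = 2 * inverse (2 * z + real (2 * m + 1))"
      using z by (auto simp: field_simps)
    with Suc.IH show ?case by simp
  qed simp
  have "(\<lambda>m. 2 * ?P (2 * z) (2 * m) - 2 * ln 2) \<longlonglongrightarrow> 2 * Digamma (2 * z) - 2 * ln 2"
    by (intro tendsto_intros P2)
  moreover have "\<forall>\<^sub>F m in sequentially. 2 * ?P (2 * z) (2 * m) - 2 * ln 2 = ?P z m + ?P (z + 1 / 2) m"
    using eventually_gt_at_top[of 0]
  proof eventually_elim
    case (elim m)
    thus ?case using sum[of m] by (simp add: ln_mult algebra_simps)
  qed
  ultimately have "(\<lambda>m. ?P z m + ?P (z + 1 / 2) m) \<longlonglongrightarrow> 2 * Digamma (2 * z) - 2 * ln 2"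
    by (rule Lim_transform_eventually)
  moreover have "(\<lambda>m. ?P z m + ?P (z + 1 / 2) m) \<longlonglongrightarrow> Digamma z + Digamma (z + 1 / 2)"
    using z by (intro tendsto_add P) auto
  ultimately show ?thesis by (rule LIMSEQ_unique[symmetric])
qed

lemma beta1_add_Digamma:
  assumes t: "t > 0"
  shows "beta1 (t / 2) + Digamma (t / 2) - ln (t / 2) = csch_laplace t"
proof -
  have "(t / 2 + 1) / 2 = t / 4 + 1 / 2" "t / 2 / 2 = t / 4" by simp_all
  hence "beta1 (t / 2) = (Digamma (t / 4 + 1 / 2) - Digamma (t / 4)) / 2"
    unfolding beta1_def by (simp only:)
  moreover have "2 * Digamma (t / 2) = Digamma (t / 4) + Digamma (t / 4 + 1 / 2) + 2 * ln 2"
    using Digamma_duplication[of "t / 4"] t by simp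
  moreover have "ln (t / 4) = ln (t / 2) - ln 2"
    using ln_divide_pos[of "t / 2" 2] t by simp
  moreover have "b + d - n = a - m" if "b = (a - c) / 2" "2 * d = c + a + 2 * l" "m = n - l" for a b c d l m n :: real
    using that by (simp add: field_simps)
  ultimately show ?thesis
    unfolding csch_laplace_eq_Digamma[OF t] by blast
qed

text \<open>The value needs \<open>Digamma (3 / 4)\<close>.  Reflection gives its difference from \<open>Digamma (1 / 4)\<close> and
  duplication their sum.\<close>
lemma csch_laplace_1: "csch_laplace 1 = pi / 2 - euler_mascheroni - ln 2"
proof -
  have "(1 / 4 :: complex) \<notin> \<int>"
  proof
    assume "(1 / 4 :: complex) \<in> \<int>"
    then obtain n where "(1 / 4 :: complex) = of_int n" by (elim Ints_cases)
    hence "complex_of_int (n * 4) = of_int 1" unfolding of_int_mult by (metis divide_eq_eq_numeral1(1) of_int_1 of_int_numeral zero_neq_numeral)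
    hence "n * 4 = 1" by (simp only: of_int_eq_iff)
    thus False by presburger
  qed
  from Digamma_reflection[OF this]
  have "Digamma (3 / 4) - Digamma (1 / 4) = complex_of_real pi * cot (complex_of_real (pi * (1 / 4)))"
    by simp
  moreover have "Digamma (3 / 4 :: complex) = of_real (Digamma (3 / 4))" "Digamma (1 / 4 :: complex) = of_real (Digamma (1 / 4))"
    using Polygamma_of_real[of "3 / 4" 0, where 'a = complex] Polygamma_of_real[of "1 / 4" 0, where 'a = complex]
    by simp_all
  ultimately have "complex_of_real (Digamma (3 / 4) - Digamma (1 / 4)) = of_real (pi * cot (pi * (1 / 4)))"
    by (simp only: of_real_diff of_real_mult cot_of_real)
  hence "Digamma (3 / 4) - Digamma (1 / 4) = pi * cot (pi / 4 :: real)"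
    by (simp only: of_real_eq_iff) simp
  also have "cot (pi / 4 :: real) = 1" by (simp add: cot_def cos_45 sin_45)
  finally have "Digamma (3 / 4) - Digamma (1 / 4 :: real) = pi" by simp
  moreover have "Digamma (1 / 4) + Digamma (3 / 4 :: real) = 2 * Digamma (1 / 2) - 2 * ln 2"
    using Digamma_duplication[of "1 / 4"] by simp
  moreover have "Digamma (1 / 2 :: real) = - euler_mascheroni - 2 * ln 2"
    using Digamma_one_half[where 'a = real] by simp
  moreover have "ln (1 / 4 :: real) = - 2 * ln 2"
    using ln_divide_pos[of 1 4] ln_realpow[of 2 2] by simp
  ultimately show ?thesis
    using csch_laplace_eq_Digamma[of 1] by simp
qed


section \<open>The exponential integral\<close>

lemma set_integral_Ici_eq_Ioi:
  fixes f :: "real \<Rightarrow> real"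
  shows "(LBINT v:{a..}. f v) = (LBINT v:{a<..}. f v)"
  unfolding set_lebesgue_integral_def
  by (rule integral_discrete_difference[of "{a}"]) (auto simp: indicator_def)

lemma set_integrable_Ici_iff_Ioi:
  fixes f :: "real \<Rightarrow> real"
  shows "set_integrable lborel {a..} f \<longleftrightarrow> set_integrable lborel {a<..} f"
  unfolding set_integrable_def
  by (rule integrable_discrete_difference[of "{a}"]) (auto simp: indicator_def)

text \<open>The part of the exponential integrand \<open>exp (- v) / v\<close> that is left after removing
  \<open>exp (- v) * csch_defect v\<close>.  It carries the whole singularity at \<open>0\<close> and is elementary in
  \<open>exp (- v)\<close>.\<close>
definition csch_exp :: "real \<Rightarrow> real" where
  "csch_exp v = exp (- v) * (2 / sinh (2 * v))"

lemma exp_mult_csch_defect: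
  "v \<noteq> 0 \<Longrightarrow> exp (- v) / v = exp (- v) * csch_defect v + csch_exp v"
  by (simp add: csch_defect_def csch_exp_def right_diff_distrib)

text \<open>With \<open>q = exp (- v)\<close> the function is \<open>4 q^3 / (1 - q^4)\<close>, whose partial fractions have
  denominators \<open>1 + q\<close>, \<open>1 - q\<close> and \<open>1 + q^2\<close>; these give the logarithms and the arctangent.\<close>
lemma csch_exp_pos_antiderivative:
  assumes v: "v > 0"
  shows "((\<lambda>v. - (ln (1 + exp (- v)) - ln (1 - exp (- v)) - 2 * arctan (exp (- v))))
           has_real_derivative csch_exp v) (at v)"
proof -
  define q where "q = exp (- v)"
  have q: "0 < q" "q < 1" using v by (auto simp: q_def)
  have nz: "1 - q \<noteq> 0" "1 + q \<noteq> 0" "1 + q\<^sup>2 \<noteq> 0" using q by (auto simp: add_nonneg_eq_0_iff)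
  have "exp (- (2 * v)) = q\<^sup>2" "exp (2 * v) = 1 / q\<^sup>2"
    by (simp_all add: q_def power2_eq_square exp_minus field_simps flip: exp_add)
  hence "csch_exp v = q * (2 / ((1 / q\<^sup>2 - q\<^sup>2) / 2))"
    by (simp add: csch_exp_def sinh_field_def q_def)
  also have "1 / q\<^sup>2 - q\<^sup>2 = (1 - q) * (1 + q) * (1 + q\<^sup>2) / q\<^sup>2"
    using q by (simp add: field_simps power2_eq_square)
  also have "q * (2 / ((1 - q) * (1 + q) * (1 + q\<^sup>2) / q\<^sup>2 / 2)) = q / (1 + q) + q / (1 - q) - 2 * (q / (1 + q\<^sup>2))"
    using nz by (simp add: divide_simps) (simp add: algebra_simps power2_eq_square)
  finally have eq: "csch_exp v = q / (1 + q) + q / (1 - q) - 2 * (q / (1 + q\<^sup>2))" .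
  have "((\<lambda>v. - (ln (1 + exp (- v)) - ln (1 - exp (- v)) - 2 * arctan (exp (- v))))
           has_real_derivative - (- q / (1 + q) - q / (1 - q) - 2 * (- q / (1 + q\<^sup>2)))) (at v)"
    unfolding q_def using q
    by (auto intro!: derivative_eq_intros simp: q_def add_pos_pos inverse_eq_divide)
  thus ?thesis by (simp add: eq add.commute)
qed

text \<open>On the negative half-line \<open>p = exp v\<close> is the variable below \<open>1\<close>.  Replacing \<open>q\<close> by \<open>1 / p\<close> keeps
  the logarithms and reverses the sign of the arctangent, up to a constant.\<close>
lemma csch_exp_neg_antiderivative:
  assumes v: "v < 0"
  shows "((\<lambda>v. - (ln (1 + exp v) - ln (1 - exp v) + 2 * arctan (exp v)))
           has_real_derivative csch_exp v) (at v)"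
proof -
  define p where "p = exp v"
  have p: "0 < p" "p < 1" using v by (auto simp: p_def)
  have nz: "1 - p \<noteq> 0" "1 + p \<noteq> 0" "1 + p\<^sup>2 \<noteq> 0" "p \<noteq> 0" using p by (auto simp: add_nonneg_eq_0_iff)
  have "exp (2 * v) = p\<^sup>2" "exp (- (2 * v)) = 1 / p\<^sup>2" "exp (- v) = 1 / p"
    by (simp_all add: p_def power2_eq_square exp_minus field_simps flip: exp_add)
  hence "csch_exp v = 1 / p * (2 / ((p\<^sup>2 - 1 / p\<^sup>2) / 2))"
    by (simp add: csch_exp_def sinh_field_def)
  also have "p\<^sup>2 - 1 / p\<^sup>2 = - ((1 - p) * (1 + p) * (1 + p\<^sup>2) / p\<^sup>2)"
    using p by (simp add: field_simps power2_eq_square)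
  also have "1 / p * (2 / (- ((1 - p) * (1 + p) * (1 + p\<^sup>2) / p\<^sup>2) / 2)) = - (p / (1 + p)) - p / (1 - p) - 2 * (p / (1 + p\<^sup>2))"
    using nz by (simp add: divide_simps) (simp add: algebra_simps power2_eq_square)
  finally have eq: "csch_exp v = - (p / (1 + p)) - p / (1 - p) - 2 * (p / (1 + p\<^sup>2))" .
  have "((\<lambda>v. - (ln (1 + exp v) - ln (1 - exp v) + 2 * arctan (exp v)))
           has_real_derivative - (p / (1 + p) + p / (1 - p) + 2 * (p / (1 + p\<^sup>2)))) (at v)"
    unfolding p_def using p
    by (auto intro!: derivative_eq_intros simp: p_def add_pos_pos inverse_eq_divide)
  thus ?thesis by (simp add: eq)
qed

lemma isCont_csch_exp: "v \<noteq> 0 \<Longrightarrow> isCont csch_exp v"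
  unfolding csch_exp_def by (intro continuous_intros) auto

lemma csch_exp_half_line:
  assumes a: "a > 0"
  shows "set_integrable lborel {a..} csch_exp"
    and "(LBINT v:{a..}. csch_exp v) = ln (1 + exp (- a)) - ln (1 - exp (- a)) - 2 * arctan (exp (- a))"
proof -
  let ?F = "\<lambda>v. - (ln (1 + exp (- v)) - ln (1 - exp (- v)) - 2 * arctan (exp (- v))) :: real"
  have "1 + exp (- a) \<noteq> 0" using exp_gt_zero[of "- a"] by linarith
  hence "(?F \<longlongrightarrow> ?F a) (at_right a)"
    using a by (intro tendsto_intros) auto
  hence A: "((?F \<circ> real_of_ereal) \<longlongrightarrow> ?F a) (at_right (ereal a))"
    by (simp add: ereal_tendsto_simps)
  have e: "((\<lambda>v::real. exp (- v)) \<longlongrightarrow> 0) at_top" by real_asymp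
  have "(?F \<longlongrightarrow> - (ln (1 + 0) - ln (1 - 0) - 2 * arctan 0)) at_top"
    by (intro tendsto_intros e) auto
  hence B: "((?F \<circ> real_of_ereal) \<longlongrightarrow> 0) (at_left \<infinity>)"
    by (simp add: ereal_tendsto_simps)
  have nonneg: "AE x in lborel. ereal a < ereal x \<longrightarrow> ereal x < \<infinity> \<longrightarrow> 0 \<le> csch_exp x"
    using a by (intro AE_I2) (auto simp: csch_exp_def)
  note FTC = interval_integral_FTC_nonneg[of "ereal a" \<infinity> ?F csch_exp, OF _ _ _ nonneg A B]
  have ei: "einterval (ereal a) \<infinity> = {a<..}" by (auto simp: einterval_def)
  show "set_integrable lborel {a..} csch_exp"
    unfolding set_integrable_Ici_iff_Ioi ei[symmetric]
    using a by (intro FTC(1) csch_exp_pos_antiderivative isCont_csch_exp) auto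
  have "(LBINT v=ereal a..\<infinity>. csch_exp v) = 0 - ?F a"
    using a by (intro FTC(2) csch_exp_pos_antiderivative isCont_csch_exp) auto
  thus "(LBINT v:{a..}. csch_exp v) = ln (1 + exp (- a)) - ln (1 - exp (- a)) - 2 * arctan (exp (- a))"
    by (simp add: set_integral_Ici_eq_Ioi interval_integral_to_infinity_eq)
qed

lemma csch_exp_interval:
  assumes "0 < e" "e \<le> s"
  shows "set_integrable lborel {-s..-e} csch_exp"
    and "(LBINT v:{-s..-e}. csch_exp v) =
           (ln (1 + exp (- s)) - ln (1 - exp (- s)) + 2 * arctan (exp (- s))) -
           (ln (1 + exp (- e)) - ln (1 - exp (- e)) + 2 * arctan (exp (- e)))"
proof -
  let ?F = "\<lambda>v. - (ln (1 + exp v) - ln (1 - exp v) + 2 * arctan (exp v)) :: real"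
  have hb: "has_bochner_integral lborel (\<lambda>v. csch_exp v * indicator {-s..-e} v) (?F (- e) - ?F (- s))"
    using assms
    by (intro has_bochner_integral_FTC_Icc_real csch_exp_neg_antiderivative isCont_csch_exp) auto
  show "set_integrable lborel {-s..-e} csch_exp"
    using hb by (simp add: set_integrable_def has_bochner_integral_iff mult.commute)
  show "(LBINT v:{-s..-e}. csch_exp v) =
           (ln (1 + exp (- s)) - ln (1 - exp (- s)) + 2 * arctan (exp (- s))) -
           (ln (1 + exp (- e)) - ln (1 - exp (- e)) + 2 * arctan (exp (- e)))"
    using hb by (simp add: set_lebesgue_integral_def has_bochner_integral_iff mult.commute)
qed

lemma set_integrable_exp_csch_defect_Ici:
  "set_integrable lborel {a..} (\<lambda>v. exp (- v) * csch_defect v)"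
  using set_integrable_exp_csch_defect[of 1 a] by (simp add: set_integrable_Ici_iff_Ioi)

text \<open>Subtracting the elementary part \<open>csch_exp\<close> from the integrand of \<open>Ei (- s)\<close>; away from \<open>0\<close> both
  parts are integrable separately.\<close>
lemma Ei_minus:
  assumes s: "s > 0"
  shows "(LBINT v:{s<..}. exp (- v) * csch_defect v) =
           - Ei (- s) - (ln (1 + exp (- s)) - ln (1 - exp (- s)) - 2 * arctan (exp (- s)))"
proof -
  have "Ei (- s) = - (LBINT v:{s..}. exp (- v) / v)"
    using s by (simp add: Ei_def)
  also have "(LBINT v:{s..}. exp (- v) / v) = (LBINT v:{s..}. exp (- v) * csch_defect v + csch_exp v)"
    using s by (intro set_lebesgue_integral_cong) (auto simp: exp_mult_csch_defect)
  also have "\<dots> = (LBINT v:{s..}. exp (- v) * csch_defect v) + (LBINT v:{s..}. csch_exp v)"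
    by (intro set_integral_add(2) set_integrable_exp_csch_defect_Ici csch_exp_half_line(1) s)
  finally show ?thesis
    by (simp add: set_integral_Ici_eq_Ioi csch_exp_half_line(2)[OF s, unfolded set_integral_Ici_eq_Ioi])
qed

text \<open>The removed window has length \<open>2 e\<close> and the integrand is bounded on it, so the principal value
  of this part is the ordinary integral.\<close>
lemma punctured_integral_tendsto:
  assumes s: "s > 0"
  shows "((\<lambda>e. (LBINT v:{-s..-e}. exp (- v) * csch_defect v) + (LBINT v:{e..}. exp (- v) * csch_defect v))
           \<longlongrightarrow> (LBINT v:{-s..}. exp (- v) * csch_defect v)) (at_right 0)"
proof -
  define g where "g = (\<lambda>v. exp (- v) * csch_defect v)"
  define K where "K = (LBINT x:{0<..}. fermi x)"
  have int: "set_integrable lborel {-s..} g"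
    unfolding g_def by (rule set_integrable_exp_csch_defect_Ici)
  have split: "(LBINT v:{-s..-e}. g v) + (LBINT v:{e..}. g v) - (LBINT v:{-s..}. g v) = - (LBINT v:{-e<..<e}. g v)"
    if e: "0 < e" "e < s" for e
  proof -
    have "{-s..} = {-s..-e} \<union> ({-e<..<e} \<union> {e..})" using e by auto
    moreover have i: "set_integrable lborel {-e<..<e} g" "set_integrable lborel {e..} g" "set_integrable lborel {-s..-e} g"
      by (rule set_integrable_subset[OF int]; use e in auto)+
    moreover have "set_integrable lborel ({-e<..<e} \<union> {e..}) g"
      by (rule set_integrable_subset[OF int]; use e in auto)
    moreover have "{-s..-e} \<inter> ({-e<..<e} \<union> {e..}) = {}" "{-e<..<e} \<inter> {e..} = {}" using e by auto
    ultimately show ?thesis by (simp add: set_integral_Un)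
  qed
  have bound: "\<bar>LBINT v:{-e<..<e}. g v\<bar> \<le> 2 * e * (exp s * K)" if e: "0 < e" "e < s" for e
  proof -
    have gK: "\<bar>g v\<bar> \<le> exp s * K" if "v \<in> {-e<..<e}" for v
      unfolding g_def abs_mult K_def using that e csch_defect_bound[of v]
      by (intro mult_mono) auto
    have "norm (LBINT v. indicator {-e<..<e} v *\<^sub>R g v) \<le> (LBINT v. indicator {-e<..<e} v * (exp s * K))"
    proof (rule Bochner_Integration.integral_norm_bound_integral)
      show "integrable lborel (\<lambda>v. indicator {-e<..<e} v *\<^sub>R g v)"
        unfolding set_integrable_def[symmetric] by (rule set_integrable_subset[OF int]) (use e in auto)
      show "integrable lborel (\<lambda>v. indicator {-e<..<e} v * (exp s * K))"
        by (intro integrable_mult_left integrable_real_indicator) (use e in auto)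
      show "norm (indicator {-e<..<e} v *\<^sub>R g v) \<le> indicator {-e<..<e} v * (exp s * K)" for v
        using gK[of v] by (auto simp: indicator_def)
    qed
    also have "\<dots> = 2 * e * (exp s * K)" using e by simp
    finally show ?thesis by (simp add: set_lebesgue_integral_def)
  qed
  have "((\<lambda>e. (LBINT v:{-s..-e}. g v) + (LBINT v:{e..}. g v) - (LBINT v:{-s..}. g v)) \<longlongrightarrow> 0) (at_right 0)"
  proof (rule Lim_null_comparison)
    show "\<forall>\<^sub>F e in at_right 0. norm ((LBINT v:{-s..-e}. g v) + (LBINT v:{e..}. g v) - (LBINT v:{-s..}. g v))
        \<le> 2 * e * (exp s * K)"
      unfolding eventually_at_right_field
      by (intro exI[of _ s]) (use s split bound in auto)
    show "((\<lambda>e. 2 * e * (exp s * K)) \<longlongrightarrow> 0) (at_right 0)"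
      by (auto intro!: tendsto_eq_intros)
  qed
  thus ?thesis unfolding g_def[symmetric] by (simp add: LIM_zero_iff)
qed

text \<open>On the domain with a symmetric gap of radius \<open>e\<close> the two boundary terms of the elementary
  antiderivatives at \<open>- e\<close> and \<open>e\<close> have equal logarithms, which cancel, while the arctangents
  combine to \<open>4 arctan (exp (- e))\<close> up to sign.  The limit of this is the constant \<open>pi\<close> in the
  formula.  Together with the convergence of the regular part it shows
  that the principal value exists.\<close>
lemma Ei_plus:
  assumes s: "s > 0"
  shows "(LBINT v:{-s<..}. exp (- v) * csch_defect v) =
           pi - Ei s - (ln (1 + exp (- s)) - ln (1 - exp (- s)) + 2 * arctan (exp (- s)))"
proof -
  let ?g = "\<lambda>v. exp (- v) * csch_defect v"
  let ?N = "ln (1 + exp (- s)) - ln (1 - exp (- s)) + 2 * arctan (exp (- s))"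
  define I where "I = (\<lambda>e. (LBINT v:{-s..-e}. ?g v) + (LBINT v:{e..}. ?g v))"
  have eq: "- ((LBINT t:{-s..-e}. exp (- t) / t) + (LBINT t:{e..}. exp (- t) / t)) =
      - (I e + ?N - 4 * arctan (exp (- e)))" if e: "0 < e" "e < s" for e
  proof -
    have "(LBINT t:{-s..-e}. exp (- t) / t) = (LBINT t:{-s..-e}. ?g t + csch_exp t)"
      using e by (intro set_lebesgue_integral_cong) (auto simp: exp_mult_csch_defect)
    also have "\<dots> = (LBINT t:{-s..-e}. ?g t) + (LBINT t:{-s..-e}. csch_exp t)"
      using e by (intro set_integral_add(2) csch_exp_interval set_integrable_subset[OF set_integrable_exp_csch_defect_Ici[of "-s"]]) auto
    finally have 1: "(LBINT t:{-s..-e}. exp (- t) / t) = (LBINT t:{-s..-e}. ?g t) + (LBINT t:{-s..-e}. csch_exp t)" .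
    have "(LBINT t:{e..}. exp (- t) / t) = (LBINT t:{e..}. ?g t + csch_exp t)"
      using e by (intro set_lebesgue_integral_cong) (auto simp: exp_mult_csch_defect)
    also have "\<dots> = (LBINT t:{e..}. ?g t) + (LBINT t:{e..}. csch_exp t)"
      using e by (intro set_integral_add(2) csch_exp_half_line set_integrable_exp_csch_defect_Ici) auto
    finally have 2: "(LBINT t:{e..}. exp (- t) / t) = (LBINT t:{e..}. ?g t) + (LBINT t:{e..}. csch_exp t)" .
    show ?thesis
      unfolding 1 2 I_def using csch_exp_interval(2)[of e s] csch_exp_half_line(2)[of e] e by simp
  qed
  have I: "(I \<longlongrightarrow> (LBINT v:{-s..}. ?g v)) (at_right 0)"
    unfolding I_def by (rule punctured_integral_tendsto[OF s])
  have "((\<lambda>e. - (I e + ?N - 4 * arctan (exp (- e)))) \<longlongrightarrow>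
      - ((LBINT v:{-s..}. ?g v) + ?N - 4 * arctan (exp (- 0)))) (at_right 0)"
    by (intro tendsto_intros I)
  hence "((\<lambda>e. - ((LBINT t:{-s..-e}. exp (- t) / t) + (LBINT t:{e..}. exp (- t) / t))) \<longlongrightarrow>
      - ((LBINT v:{-s..}. ?g v) + ?N - 4 * arctan (exp (- 0)))) (at_right 0)"
    by (rule Lim_transform_eventually)
       (unfold eventually_at_right_field, intro exI[of _ s], use s eq in auto)
  hence "Ei s = - ((LBINT v:{-s..}. ?g v) + ?N - 4 * arctan (exp (- 0)))"
    unfolding Ei_def using s by (simp add: tendsto_Lim)
  thus ?thesis by (simp add: set_integral_Ici_eq_Ioi arctan_one)
qed

text \<open>Shifting the integration variable by \<open>s\<close> and by \<open>- s\<close> turns the two halves of the Poisson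
  transform into the integrals evaluated by the two exponential integrals.\<close>
lemma fermi_poisson_cosine_transform:
  assumes s: "s > 0"
  shows "(LBINT x:{0<..}. fermi x * cos (s * x) * (x / (x\<^sup>2 + 1\<^sup>2))) =
      pi / 2 * exp (- s) + 2 * sinh s * arctan (exp (- s))
        - cosh s * ln (1 + exp (- s))
        - exp (- s) / 2 * (Ei s - ln (1 - exp (- s)))
        - exp s / 2 * (Ei (- s) - ln (1 - exp (- s)))"
proof -
  have shift: "(LBINT u:{0<..}. exp (- 1 * u) * csch_defect (u + a)) =
      exp a * (LBINT v:{a<..}. exp (- v) * csch_defect v)" for a
  proof -
    have "exp (- 1 * u) * csch_defect (u + a) = exp a * (exp (- (u + a)) * csch_defect (u + a))" for u
      by (simp add: mult.assoc[symmetric] flip: exp_add)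
    thus ?thesis
      by (simp only: set_integral_Ioi_shift[of a] set_integral_mult_right)
  qed
  have int: "set_integrable lborel {0<..} (\<lambda>u. exp (- 1 * u) * csch_defect (u + a))" for a
  proof -
    have "exp (- 1 * u) * csch_defect (u + a) = exp a * (exp (- 1 * (u + a)) * csch_defect (u + a))" for u
      by (simp add: mult.assoc[symmetric] flip: exp_add)
    thus ?thesis
      using set_integrable_exp_csch_defect[of 1 a] unfolding set_integrable_Ioi_shift[of a]
      by (simp only:) (rule set_integrable_mult_right, simp)
  qed
  have "(LBINT x:{0<..}. fermi x * cos (s * x) * (x / (x\<^sup>2 + 1\<^sup>2))) =
      (LBINT u:{0<..}. exp (- 1 * u) * ((csch_defect (u + s) + csch_defect (u - s)) / 2))"
    by (rule fermi_poisson_transform) simp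
  also have "\<dots> = (LBINT u:{0<..}. (exp (- 1 * u) * csch_defect (u + s) + exp (- 1 * u) * csch_defect (u + - s)) / 2)"
    by (simp add: distrib_left)
  also have "\<dots> = ((LBINT u:{0<..}. exp (- 1 * u) * csch_defect (u + s)) +
      (LBINT u:{0<..}. exp (- 1 * u) * csch_defect (u + - s))) / 2"
    by (subst set_integral_divide_zero, subst set_integral_add(2)[OF int int]) (rule refl)
  also have "\<dots> = (exp s * (LBINT v:{s<..}. exp (- v) * csch_defect v) +
      exp (- s) * (LBINT v:{- s<..}. exp (- v) * csch_defect v)) / 2"
    by (simp only: shift)
  finally show ?thesis
    unfolding Ei_minus[OF s] Ei_plus[OF s]
    by (simp add: sinh_field_def cosh_field_def field_simps)
qed


section \<open>The spectral measure\<close>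

lemma exp_over_cosh_eq_fermi: "exp (- pi * y / 4) / cosh (pi * y / 4) = fermi y"
proof -
  have "cosh (pi * y / 4) = exp (- pi * y / 4) * (1 + exp (pi * y / 2)) / 2"
    by (simp add: cosh_field_def distrib_left flip: exp_add)
  thus ?thesis unfolding fermi_def by (simp only:) simp
qed

text \<open>The factor \<open>1 / 2\<close> appears because the measure lives on the whole line, whereas the transforms
  above are integrals over the half-line.\<close>
definition spectral_density :: "real \<Rightarrow> real" where
  "spectral_density x = \<bar>x\<bar> / (1 + x\<^sup>2) * fermi \<bar>x\<bar> / 2"

definition spectral_measure :: "real measure" where
  "spectral_measure = density lborel (\<lambda>x. ennreal (spectral_density x))"

lemma spectral_density_nonneg: "spectral_density x \<ge> 0"
  using fermi_pos[of "\<bar>x\<bar>"] by (simp add: spectral_density_def)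

lemma spectral_density_measurable [measurable]: "spectral_density \<in> borel_measurable borel"
  unfolding spectral_density_def by measurable

lemma integrable_spectral_density: "integrable lborel spectral_density"
proof (rule Bochner_Integration.integrable_bound)
  have "(\<lambda>x. indicator {0..} x *\<^sub>R fermi \<bar>x\<bar>) = (\<lambda>x. indicator {0..} x *\<^sub>R fermi x)"
    by (auto simp: indicator_def)
  hence "has_bochner_integral lborel (\<lambda>x. indicator {0..} x *\<^sub>R fermi \<bar>x\<bar>)
      (LBINT x. indicator {0..} x *\<^sub>R fermi x)"
    using set_integrable_fermi[folded set_integrable_Ici_iff_Ioi]
    by (simp add: set_integrable_def has_bochner_integral_iff)
  from has_bochner_integral_even_function[OF this]
  show "integrable lborel (\<lambda>x. fermi \<bar>x\<bar>)" by (auto simp: has_bochner_integral_iff)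
  show "AE x in lborel. norm (spectral_density x) \<le> norm (fermi \<bar>x\<bar>)"
  proof (intro AE_I2)
    fix x :: real
    have "\<bar>x\<bar> \<le> 1 + \<bar>x\<bar>\<^sup>2"
      using zero_le_power2[of "\<bar>x\<bar> - 1"] by (simp add: power2_diff) 
    hence "\<bar>x\<bar> / (1 + x\<^sup>2) \<le> 1" by (simp add: divide_le_eq add_pos_nonneg)
    hence weight_le: "\<bar>x\<bar> / (1 + x\<^sup>2) * fermi \<bar>x\<bar> \<le> 1 * fermi \<bar>x\<bar>"
      using fermi_pos[of "\<bar>x\<bar>"] by (intro mult_right_mono) auto
    have half_le: "a / 2 \<le> b" if "a \<le> 1 * b" "0 < b" for a b :: real
      using that by simp
    show "norm (spectral_density x) \<le> norm (fermi \<bar>x\<bar>)"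
      unfolding real_norm_def abs_of_nonneg[OF spectral_density_nonneg] abs_of_pos[OF fermi_pos]
      unfolding spectral_density_def by (rule half_le[OF weight_le fermi_pos])
  qed
qed simp

lemma finite_borel_measure_spectral: "finite_borel_measure spectral_measure"
proof (intro finite_borel_measure.intro finite_measureI finite_borel_measure_axioms.intro)
  have "emeasure spectral_measure (space spectral_measure) = (\<integral>\<^sup>+x. ennreal (spectral_density x) \<partial>lborel)"
    by (simp add: spectral_measure_def emeasure_density)
  also have "\<dots> < \<infinity>"
    using integrable_spectral_density spectral_density_nonneg
    by (simp add: integrable_iff_bounded)
  finally show "emeasure spectral_measure (space spectral_measure) \<noteq> \<infinity>" by simp
qed (simp add: spectral_measure_def)

lemma integrable_spectral_bounded:
  fixes f :: "real \<Rightarrow> real"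
  assumes [measurable]: "f \<in> borel_measurable borel" and "\<And>x. \<bar>f x\<bar> \<le> C"
  shows "integrable spectral_measure f"
proof -
  interpret finite_borel_measure spectral_measure by (rule finite_borel_measure_spectral)
  show ?thesis
    by (rule integrable_const_bound[of _ C]) (use assms in \<open>auto simp: spectral_measure_def\<close>)
qed

lemma spectral_integral_lborel:
  fixes f :: "real \<Rightarrow> real"
  assumes [measurable]: "f \<in> borel_measurable borel"
  shows "integrable spectral_measure f \<longleftrightarrow> integrable lborel (\<lambda>x. spectral_density x * f x)"
    and "(LINT x|spectral_measure. f x) = (LBINT x. spectral_density x * f x)"
  using spectral_density_nonneg by (simp_all add: spectral_measure_def integrable_real_density integral_real_density)

text \<open>By symmetry of the density only the half-line matters, and there the integral is of the form
  evaluated above; its kernel is written with \<open>1^2\<close> to be the Poisson kernel at \<open>t = 1\<close>.\<close>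
lemma spectral_integral_even:
  fixes f :: "real \<Rightarrow> real"
  assumes f [measurable]: "f \<in> borel_measurable borel" and "\<And>x. \<bar>f x\<bar> \<le> C" and even: "\<And>x. f (- x) = f x"
  shows "(LINT x|spectral_measure. f x) = (LBINT x:{0<..}. fermi x * f x * (x / (x\<^sup>2 + 1\<^sup>2)))"
proof -
  let ?g = "\<lambda>x. spectral_density x * f x"
  have int: "integrable lborel ?g"
    using integrable_spectral_bounded[OF assms(1,2)] by (simp only: spectral_integral_lborel(1)[OF f])
  have "integrable lborel (\<lambda>x. indicator {0..} x *\<^sub>R ?g x)"
    using integrable_mult_indicator[OF _ int, of "{0..}"] by simp
  hence "has_bochner_integral lborel (\<lambda>x. indicator {0..} x *\<^sub>R ?g x) (LBINT x:{0..}. ?g x)"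
    by (simp add: has_bochner_integral_iff set_lebesgue_integral_def)
  from has_bochner_integral_even_function[OF this]
  have "(LBINT x. ?g x) = 2 * (LBINT x:{0..}. ?g x)"
    by (auto simp: has_bochner_integral_iff even spectral_density_def)
  also have "\<dots> = (LBINT x:{0<..}. 2 * ?g x)" by (simp add: set_integral_Ici_eq_Ioi)
  also have "\<dots> = (LBINT x:{0<..}. fermi x * f x * (x / (x\<^sup>2 + 1\<^sup>2)))"
  proof (intro set_lebesgue_integral_cong allI impI)
    fix x :: real assume "x \<in> {0<..}"
    moreover have "2 * (a / 2 * b) = a * b" for a b :: real by simp
    ultimately show "2 * ?g x = fermi x * f x * (x / (x\<^sup>2 + 1\<^sup>2))"
      unfolding spectral_density_def by (simp only:) (simp add: add.commute)
  qed simp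
  finally show ?thesis by (simp only: spectral_integral_lborel(2)[OF f])
qed

lemma spectral_integral_odd:
  fixes f :: "real \<Rightarrow> real"
  assumes f [measurable]: "f \<in> borel_measurable borel" and odd: "\<And>x. f (- x) = - f x"
  shows "(LINT x|spectral_measure. f x) = 0"
proof -
  let ?g = "\<lambda>x. spectral_density x * f x"
  have "(LBINT x. ?g x) = (LBINT x. ?g (- x))"
    using lborel_integral_real_affine[of "-1" ?g 0] by simp
  also have "(\<lambda>x. ?g (- x)) = (\<lambda>x. - ?g x)" by (auto simp: odd spectral_density_def)
  finally show ?thesis by (simp add: spectral_integral_lborel(2)[OF f])
qed

lemma csch_laplace_eq_fermi:
  assumes t: "t > 0"
  shows "csch_laplace t = (LBINT x:{0<..}. fermi x * (x / (x\<^sup>2 + t\<^sup>2)))"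
  using fermi_poisson_transform[OF t, of 0] by (simp add: csch_laplace_def)

lemma spectral_measure_mass: "measure spectral_measure UNIV = csch_laplace 1"
proof -
  interpret finite_borel_measure spectral_measure by (rule finite_borel_measure_spectral)
  have "measure spectral_measure UNIV = (LINT x|spectral_measure. 1)"
    by (simp add: spectral_measure_def)
  also have "\<dots> = (LBINT x:{0<..}. fermi x * 1 * (x / (x\<^sup>2 + 1\<^sup>2)))"
    by (rule spectral_integral_even[where C = 1]) auto
  finally show ?thesis by (simp add: csch_laplace_eq_fermi)
qed

lemma spectral_integral_Complex:
  fixes f g :: "real \<Rightarrow> real"
  assumes "integrable spectral_measure f" "integrable spectral_measure g"
  shows "(CLINT x|spectral_measure. Complex (f x) (g x)) =
      Complex (LINT x|spectral_measure. f x) (LINT x|spectral_measure. g x)"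
proof -
  have "(CLINT x|spectral_measure. of_real (f x) + \<i> * of_real (g x)) =
      of_real (LINT x|spectral_measure. f x) + \<i> * of_real (LINT x|spectral_measure. g x)"
    using assms by (simp add: Bochner_Integration.integral_add)
  thus ?thesis by (simp add: Complex_eq)
qed

lemma char_spectral:
  "char spectral_measure s = of_real (LBINT x:{0<..}. fermi x * cos (s * x) * (x / (x\<^sup>2 + 1\<^sup>2)))"
proof -
  have "char spectral_measure s = (CLINT x|spectral_measure. Complex (cos (s * x)) (sin (s * x)))"
    unfolding char_def by (intro Bochner_Integration.integral_cong refl) (simp add: complex_eq_iff Re_exp Im_exp)
  also have "\<dots> = Complex (LINT x|spectral_measure. cos (s * x)) (LINT x|spectral_measure. sin (s * x))"
    by (intro spectral_integral_Complex integrable_spectral_bounded[where C = 1]) auto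
  also have "(LINT x|spectral_measure. sin (s * x)) = 0"
    by (rule spectral_integral_odd) auto
  also have "(LINT x|spectral_measure. cos (s * x)) = (LBINT x:{0<..}. fermi x * cos (s * x) * (x / (x\<^sup>2 + 1\<^sup>2)))"
    by (rule spectral_integral_even[where C = 1]) auto
  finally show ?thesis by (simp add: complex_of_real_def)
qed

text \<open>The real part of the Nevanlinna kernel at \<open>i t\<close> is odd in \<open>x\<close> and integrates to zero.  The
  imaginary part is even, and its factor \<open>1 + x^2\<close> cancels that of the density, which leaves the
  Poisson kernel at \<open>\<bar>t\<bar>\<close>.\<close>
lemma spectral_Nevanlinna_integral:
  fixes t :: real assumes t: "t \<noteq> 0"
  shows "(CLINT x|spectral_measure. (1 + \<i> * of_real t * of_real x) / (\<i> * of_real t - of_real x)) =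
      - \<i> * of_real (t * csch_laplace \<bar>t\<bar>)"
proof -
  let ?f = "\<lambda>x. (t\<^sup>2 - 1) * x / (x\<^sup>2 + t\<^sup>2)" and ?g = "\<lambda>x. - t * (1 + x\<^sup>2) / (x\<^sup>2 + t\<^sup>2)"
  have pos: "x\<^sup>2 + t\<^sup>2 > 0" for x using t by (simp add: add_nonneg_pos)
  have eq: "(1 + \<i> * of_real t * of_real x) / (\<i> * of_real t - of_real x) = Complex (?f x) (?g x)" for x
  proof -
    have "\<i> * of_real t - of_real x \<noteq> 0" using t by (auto simp: complex_eq_iff)
    moreover have "Complex (?f x) (?g x) * (\<i> * of_real t - of_real x) = 1 + \<i> * of_real t * of_real x"
    proof -
      define D where "D = x\<^sup>2 + t\<^sup>2"
      have "D \<noteq> 0" using pos[of x] unfolding D_def by linarith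
      hence "- ((t\<^sup>2 - 1) * x / D * x) - (- t * (1 + x\<^sup>2) / D) * t = 1"
        "(t\<^sup>2 - 1) * x / D * t - (- t * (1 + x\<^sup>2) / D) * x = t * x"
        by (simp add: field_simps, simp add: D_def power2_eq_square algebra_simps)+
      hence "- (?f x * x) - ?g x * t = 1" "?f x * t - ?g x * x = t * x"
        by (simp_all only: D_def)
      thus ?thesis by (simp add: complex_eq_iff algebra_simps)
    qed
    ultimately show ?thesis by (simp add: divide_eq_eq)
  qed
  have g_le: "(1 + x\<^sup>2) / (x\<^sup>2 + t\<^sup>2) \<le> 1 + 1 / t\<^sup>2" for x
  proof -
    have "1 / (x\<^sup>2 + t\<^sup>2) \<le> 1 / t\<^sup>2" using t pos[of x] by (intro divide_left_mono) auto
    moreover have "x\<^sup>2 / (x\<^sup>2 + t\<^sup>2) \<le> 1" using pos[of x] by (simp add: divide_le_eq)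
    ultimately show ?thesis by (simp add: add_divide_distrib)
  qed
  have x_le: "\<bar>x\<bar> \<le> 1 + x\<^sup>2" for x :: real
    using zero_le_power2[of "\<bar>x\<bar> - 1"] by (simp add: power2_diff)
  have "(CLINT x|spectral_measure. Complex (?f x) (?g x)) =
      Complex (LINT x|spectral_measure. ?f x) (LINT x|spectral_measure. ?g x)"
  proof (rule spectral_integral_Complex)
    show "integrable spectral_measure ?f"
    proof (rule integrable_spectral_bounded[where C = "\<bar>t\<^sup>2 - 1\<bar> * (1 + 1 / t\<^sup>2)"])
      show "\<bar>?f x\<bar> \<le> \<bar>t\<^sup>2 - 1\<bar> * (1 + 1 / t\<^sup>2)" for x
      proof -
        have "\<bar>x\<bar> / (x\<^sup>2 + t\<^sup>2) \<le> (1 + x\<^sup>2) / (x\<^sup>2 + t\<^sup>2)"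
          using x_le pos[of x] by (intro divide_right_mono) auto
        hence "\<bar>x\<bar> / (x\<^sup>2 + t\<^sup>2) \<le> 1 + 1 / t\<^sup>2" using g_le[of x] by linarith
        from mult_left_mono[OF this, of "\<bar>t\<^sup>2 - 1\<bar>"] show ?thesis
          using pos[of x] by (simp add: abs_mult)
      qed
    qed measurable
    show "integrable spectral_measure ?g"
    proof (rule integrable_spectral_bounded[where C = "\<bar>t\<bar> * (1 + 1 / t\<^sup>2)"])
      show "\<bar>?g x\<bar> \<le> \<bar>t\<bar> * (1 + 1 / t\<^sup>2)" for x
        using mult_left_mono[OF g_le[of x], of "\<bar>t\<bar>"] pos[of x] by (simp add: abs_mult add_nonneg_nonneg)
    qed measurable
  qed
  also have "(LINT x|spectral_measure. ?f x) = 0"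
    by (rule spectral_integral_odd) auto
  also have "(LINT x|spectral_measure. ?g x) = (LBINT x:{0<..}. fermi x * ?g x * (x / (x\<^sup>2 + 1\<^sup>2)))"
  proof (rule spectral_integral_even[where C = "\<bar>t\<bar> * (1 + 1 / t\<^sup>2)"])
    show "\<bar>?g x\<bar> \<le> \<bar>t\<bar> * (1 + 1 / t\<^sup>2)" for x
      using mult_left_mono[OF g_le[of x], of "\<bar>t\<bar>"] pos[of x] by (simp add: abs_mult add_nonneg_nonneg)
  qed auto
  also have "\<dots> = (LBINT x:{0<..}. - t * (fermi x * (x / (x\<^sup>2 + \<bar>t\<bar>\<^sup>2))))"
  proof (intro set_lebesgue_integral_cong allI impI)
    fix x :: real
    have cancel: "(1 + x\<^sup>2) * (x / (x\<^sup>2 + 1\<^sup>2)) = x"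
      using add_pos_nonneg[of 1 "x\<^sup>2"] by (simp add: add.commute)
    have "w * (- t * A / D) * K = - t * (w * (A * K / D))" for w A D K :: real by simp
    thus "fermi x * ?g x * (x / (x\<^sup>2 + 1\<^sup>2)) = - t * (fermi x * (x / (x\<^sup>2 + \<bar>t\<bar>\<^sup>2)))"
      by (simp only: cancel power2_abs)
  qed simp
  also have "\<dots> = - (t * csch_laplace \<bar>t\<bar>)"
    unfolding set_integral_mult_right using t by (subst csch_laplace_eq_fermi) auto
  finally show ?thesis by (simp add: eq complex_eq_iff)
qed

section \<open>The integral representation\<close>

theorem proposition3:
  fixes V_C V_S V_T :: "complex \<Rightarrow> complex"
  assumes V_C: "\<And>t::real. t > 0 \<Longrightarrow>
      V_C (\<i> * complex_of_real t) = \<i> * complex_of_real (1 - t * beta1 (t / 2))"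
    and V_S: "\<And>t::real. t > 0 \<Longrightarrow>
      V_S (\<i> * complex_of_real t) =
        \<i> * complex_of_real (t * Digamma (t / 2) - t * ln (t / 2) + 1)"
    and V_T_pos: "\<And>t::real. t > 0 \<Longrightarrow>
      V_T (\<i> * complex_of_real t) = V_C (\<i> * complex_of_real t) - V_S (\<i> * complex_of_real t)"
    and V_T_neg: "\<And>t::real. t > 0 \<Longrightarrow>
      V_T (- (\<i> * complex_of_real t)) = cnj (V_T (\<i> * complex_of_real t))"
  shows "(\<forall>t::real. t > 0 \<longrightarrow>
      V_T (\<i> * complex_of_real t) =
        \<i> * complex_of_real t * complex_of_real (ln (t / 2) - beta1 (t / 2) - Digamma (t / 2)))
    \<and> (\<exists>(a::real) (m::real measure).
        finite_borel_measure m
      \<and> (\<forall>t::real. t \<noteq> 0 \<longrightarrow>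
          V_T (\<i> * complex_of_real t) =
            complex_of_real a +
            (CLINT x|m. (1 + \<i> * complex_of_real t * complex_of_real x)
                          / (\<i> * complex_of_real t - complex_of_real x)))
      \<and> a = 0
      \<and> measure m UNIV = pi / 2 - euler_mascheroni - ln 2
      \<and> (\<forall>s::real. s > 0 \<longrightarrow>
          char m s = complex_of_real
            (pi / 2 * exp (- s) + 2 * sinh s * arctan (exp (- s))
              - cosh s * ln (1 + exp (- s))
              - exp (- s) / 2 * (Ei s - ln (1 - exp (- s)))
              - exp s / 2 * (Ei (- s) - ln (1 - exp (- s))))
        \<and> char m s = complex_of_real
            (LBINT x:{0..}. cos (s * x) * (\<bar>x\<bar> / (1 + x\<^sup>2))
               * (exp (- pi * \<bar>x\<bar> / 4) / cosh (pi * \<bar>x\<bar> / 4)))))"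
proof -
  have V_T: "V_T (\<i> * complex_of_real t) =
        \<i> * complex_of_real t * complex_of_real (ln (t / 2) - beta1 (t / 2) - Digamma (t / 2))"
    if "t > 0" for t :: real
    unfolding V_T_pos[OF that] V_C[OF that] V_S[OF that] by (simp add: algebra_simps)
  \<comment> \<open>For negative \<open>t\<close> conjugation changes only the sign, since the value at \<open>i \<bar>t\<bar>\<close> is imaginary.\<close>
  have V_T': "V_T (\<i> * complex_of_real t) = - \<i> * of_real (t * csch_laplace \<bar>t\<bar>)" if "t \<noteq> 0" for t :: real
  proof -
    have pos: "V_T (\<i> * complex_of_real u) = - \<i> * of_real (u * csch_laplace u)" if "u > 0" for u :: real
    proof -
      have "ln (u / 2) - beta1 (u / 2) - Digamma (u / 2) = - csch_laplace u"
        using beta1_add_Digamma[OF that] by linarith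
      thus ?thesis unfolding V_T[OF that] by simp
    qed
    show ?thesis
    proof (cases "t > 0")
      case True
      thus ?thesis using pos[of t] by simp
    next
      case False
      hence "- t > 0" using \<open>t \<noteq> 0\<close> by simp
      from V_T_neg[OF this] pos[OF this] False show ?thesis by simp
    qed
  qed
  have "char spectral_measure s = complex_of_real
            (LBINT x:{0..}. cos (s * x) * (\<bar>x\<bar> / (1 + x\<^sup>2))
               * (exp (- pi * \<bar>x\<bar> / 4) / cosh (pi * \<bar>x\<bar> / 4)))" for s
    unfolding char_spectral set_integral_Ici_eq_Ioi exp_over_cosh_eq_fermi of_real_eq_iff
    by (intro set_lebesgue_integral_cong) (auto simp: add.commute)
  moreover have "measure spectral_measure UNIV = pi / 2 - euler_mascheroni - ln 2"
    unfolding spectral_measure_mass by (rule csch_laplace_1)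
  moreover have "V_T (\<i> * complex_of_real t) = complex_of_real 0 +
            (CLINT x|spectral_measure. (1 + \<i> * complex_of_real t * complex_of_real x)
                          / (\<i> * complex_of_real t - complex_of_real x))" if "t \<noteq> 0" for t
    unfolding spectral_Nevanlinna_integral[OF that] V_T'[OF that] by simp
  moreover have "char spectral_measure s = complex_of_real
            (pi / 2 * exp (- s) + 2 * sinh s * arctan (exp (- s))
              - cosh s * ln (1 + exp (- s))
              - exp (- s) / 2 * (Ei s - ln (1 - exp (- s)))
              - exp s / 2 * (Ei (- s) - ln (1 - exp (- s))))" if "s > 0" for s
    unfolding char_spectral fermi_poisson_cosine_transform[OF that] ..
  ultimately show ?thesis
    using V_T finite_borel_measure_spectral by blast
qed

end
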